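(* There exist compact metrizable spaces $X$ and $Y$ and an open continuous map $f\colon X\to Y$ all of whose fibers $f^{-1}(y)$, $y\in Y$, are infinite, such that the map $I(f)\colon I(X)\to I(Y)$ is not a trivial $Q$-bundle.
   Context: All maps are continuous. For a compact Hausdorff space $X$, $C(X)$ denotes the set of continuous functions $X\to\mathbb R$, and $c_X\in C(X)$ is the constant function with value $c\in\mathbb R$. For $c\in\mathbb R$ and $\varphi,\psi\in C(X)$ put $c\odot\varphi=c_X+\varphi$ and $\varphi\oplus\psi=\max\{\varphi,\psi\}$ (pointwise); for real numbers $a,b$ put $a\odot b=a+b$, $a\oplus b=\max\{a,b\}$. A functional $\mu\colon C(X)\to\mathbb R$ (not assumed linear) is an idempotent probability measure if $\mu(c_X)=c$, $\mu(c\odot\varphi)=c\odot\mu(\varphi)$ and $\mu(\varphi\oplus\psi)=\mu(\varphi)\oplus\mu(\psi)$ for all $c\in\mathbb R$, $\varphi,\psi\in C(X)$. $I(X)$ is the set of all idempotent probability measures on $X$ with the weak* topology, whose basis consists of the sets $\{\nu\in I(X): |\mu(\varphi_i)-\nu(\varphi_i)|<\varepsilon,\ i=1,\dots,n\}$, where $\mu\in I(X)$, $\varphi_1,\dots,\varphi_n\in C(X)$, $\varepsilon>0$. For a map $f\colon X\to Y$ of compact Hausdorff spaces, $I(f)\colon I(X)\to I(Y)$ is the continuous map $I(f)(\mu)(\varphi)=\mu(\varphi\circ f)$, $\varphi\in C(Y)$. $Q=\prod_{i=1}^\infty[0,1]$ is the Hilbert cube. A map $g\colon E\to B$ is a trivial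 $Q$-bundle if it is homeomorphic to the projection $p_1\colon B\times Q\to B$, i.e. there is a homeomorphism $h\colon E\to B\times Q$ with $p_1\circ h=g$. *)

theory Defs
  imports "HOL-Analysis.Analysis"
begin

text \<open>
  Spaces are topologies on a carrier set \<^term>\<open>topspace X\<close>. Functions on the carrier
  are total HOL functions, normalised to \<^term>\<open>undefined\<close> outside of it, so that equality
  in \<open>C_fun X\<close> (and likewise for functionals in \<open>I_set X\<close>) is equality on the carrier.
  A claim that some compact metrizable space exists may be stated for topologies on
  \<^typ>\<open>nat \<Rightarrow> real\<close>: every such space embeds into the Hilbert cube.
\<close>

definition C_fun :: "'a topology \<Rightarrow> ('a \<Rightarrow> real) set" where
  "C_fun X = {\<phi>. continuous_map X euclideanreal \<phi> \<and> \<phi> \<in> extensional (topspace X)}"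

definition C_const :: "'a topology \<Rightarrow> real \<Rightarrow> 'a \<Rightarrow> real" where
  "C_const X c = (\<lambda>x\<in>topspace X. c)"

definition C_odot :: "'a topology \<Rightarrow> real \<Rightarrow> ('a \<Rightarrow> real) \<Rightarrow> 'a \<Rightarrow> real" where
  "C_odot X c \<phi> = (\<lambda>x\<in>topspace X. C_const X c x + \<phi> x)"

definition C_oplus :: "'a topology \<Rightarrow> ('a \<Rightarrow> real) \<Rightarrow> ('a \<Rightarrow> real) \<Rightarrow> 'a \<Rightarrow> real" where
  "C_oplus X \<phi> \<psi> = (\<lambda>x\<in>topspace X. max (\<phi> x) (\<psi> x))"

definition idempotent_prob_measure ::
    "'a topology \<Rightarrow> (('a \<Rightarrow> real) \<Rightarrow> real) \<Rightarrow> bool" where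
  "idempotent_prob_measure X \<mu> \<longleftrightarrow>
     (\<forall>c. \<mu> (C_const X c) = c) \<and>
     (\<forall>c. \<forall>\<phi>\<in>C_fun X. \<mu> (C_odot X c \<phi>) = c + \<mu> \<phi>) \<and>
     (\<forall>\<phi>\<in>C_fun X. \<forall>\<psi>\<in>C_fun X. \<mu> (C_oplus X \<phi> \<psi>) = max (\<mu> \<phi>) (\<mu> \<psi>))"

definition I_set :: "'a topology \<Rightarrow> (('a \<Rightarrow> real) \<Rightarrow> real) set" where
  "I_set X = {\<mu>. \<mu> \<in> extensional (C_fun X) \<and> idempotent_prob_measure X \<mu>}"

definition I_nbhd ::
    "'a topology \<Rightarrow> (('a \<Rightarrow> real) \<Rightarrow> real) \<Rightarrow> ('a \<Rightarrow> real) set \<Rightarrow> real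
      \<Rightarrow> (('a \<Rightarrow> real) \<Rightarrow> real) set" where
  "I_nbhd X \<mu> F \<epsilon> = {\<nu> \<in> I_set X. \<forall>\<phi>\<in>F. \<bar>\<mu> \<phi> - \<nu> \<phi>\<bar> < \<epsilon>}"

text \<open>
  The generating family is a basis, not just a subbasis: see \<open>openin_I_top\<close> below.
\<close>

definition I_top :: "'a topology \<Rightarrow> (('a \<Rightarrow> real) \<Rightarrow> real) topology" where
  "I_top X = topology_generated_by
     {I_nbhd X \<mu> F \<epsilon> |\<mu> F \<epsilon>. \<mu> \<in> I_set X \<and> finite F \<and> F \<subseteq> C_fun X \<and> \<epsilon> > 0}"

definition I_map ::
    "'a topology \<Rightarrow> 'b topology \<Rightarrow> ('a \<Rightarrow> 'b)
      \<Rightarrow> (('a \<Rightarrow> real) \<Rightarrow> real) \<Rightarrow> (('b \<Rightarrow> real) \<Rightarrow> real)" where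
  "I_map X Y f \<mu> = (\<lambda>\<phi>\<in>C_fun Y. \<mu> (restrict (\<phi> \<circ> f) (topspace X)))"

definition Hilbert_cube :: "(nat \<Rightarrow> real) topology" where
  "Hilbert_cube = product_topology (\<lambda>_. top_of_set {0..1}) UNIV"

definition trivial_Q_bundle :: "'e topology \<Rightarrow> 'b topology \<Rightarrow> ('e \<Rightarrow> 'b) \<Rightarrow> bool" where
  "trivial_Q_bundle E B g \<longleftrightarrow>
     (\<exists>h. homeomorphic_map E (prod_topology B Hilbert_cube) h \<and>
          (\<forall>e\<in>topspace E. fst (h e) = g e))"

lemma I_nbhd_self:
  assumes "\<mu> \<in> I_set X" "\<epsilon> > 0"
  shows "\<mu> \<in> I_nbhd X \<mu> F \<epsilon>"
  using assms by (simp add: I_nbhd_def)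

lemma topspace_I_top [simp]: "topspace (I_top X) = I_set X"
proof
  show "topspace (I_top X) \<subseteq> I_set X"
    unfolding I_top_def topology_generated_by_topspace by (auto simp: I_nbhd_def)
  show "I_set X \<subseteq> topspace (I_top X)"
  proof
    fix \<mu> assume "\<mu> \<in> I_set X"
    then have "\<mu> \<in> I_nbhd X \<mu> {} 1" by (simp add: I_nbhd_self)
    with \<open>\<mu> \<in> I_set X\<close> show "\<mu> \<in> topspace (I_top X)"
      unfolding I_top_def topology_generated_by_topspace
      by (intro UnionI[of "I_nbhd X \<mu> {} 1"]) (auto intro!: exI[of _ \<mu>] exI[of _ "{}"] exI[of _ "1::real"])
  qed
qed

lemma I_nbhd_shrink:
  assumes "\<nu> \<in> I_nbhd X \<mu> F \<epsilon>" "finite F" "\<epsilon> > 0"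
  obtains \<delta> where "\<delta> > 0" "I_nbhd X \<nu> F \<delta> \<subseteq> I_nbhd X \<mu> F \<epsilon>"
proof -
  define \<delta> where "\<delta> = Min (insert \<epsilon> ((\<lambda>\<phi>. \<epsilon> - \<bar>\<mu> \<phi> - \<nu> \<phi>\<bar>) ` F))"
  have "\<delta> > 0"
    unfolding \<delta>_def using assms by (auto simp: I_nbhd_def)
  moreover have "\<delta> \<le> \<epsilon> - \<bar>\<mu> \<phi> - \<nu> \<phi>\<bar>" if "\<phi> \<in> F" for \<phi>
    unfolding \<delta>_def using assms that by (intro Min_le) auto
  then have "I_nbhd X \<nu> F \<delta> \<subseteq> I_nbhd X \<mu> F \<epsilon>"
    by (fastforce simp: I_nbhd_def)
  ultimately show thesis by (rule that)
qed

lemma openin_I_top: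
  "openin (I_top X) U \<longleftrightarrow>
     U \<subseteq> I_set X \<and>
     (\<forall>\<mu>\<in>U. \<exists>F \<epsilon>. finite F \<and> F \<subseteq> C_fun X \<and> \<epsilon> > 0 \<and> I_nbhd X \<mu> F \<epsilon> \<subseteq> U)"
  (is "?L \<longleftrightarrow> ?R")
proof
  assume ?L
  then have sub: "U \<subseteq> I_set X"
    using openin_subset by fastforce
  have "generate_topology_on
     {I_nbhd X \<mu> F \<epsilon> |\<mu> F \<epsilon>. \<mu> \<in> I_set X \<and> finite F \<and> F \<subseteq> C_fun X \<and> \<epsilon> > 0} U"
    using \<open>?L\<close> by (simp add: I_top_def openin_topology_generated_by_iff)
  then have "\<forall>\<mu>\<in>U. \<exists>F \<epsilon>. finite F \<and> F \<subseteq> C_fun X \<and> \<epsilon> > 0 \<and> I_nbhd X \<mu> F \<epsilon> \<subseteq> U"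
  proof induction
    case Empty
    then show ?case by simp
  next
    case (Int a b)
    show ?case
    proof
      fix \<mu> assume "\<mu> \<in> a \<inter> b"
      then obtain F \<epsilon> G \<delta> where *:
        "finite F" "F \<subseteq> C_fun X" "\<epsilon> > 0" "I_nbhd X \<mu> F \<epsilon> \<subseteq> a"
        "finite G" "G \<subseteq> C_fun X" "\<delta> > 0" "I_nbhd X \<mu> G \<delta> \<subseteq> b"
        using Int.IH by (meson IntD1 IntD2)
      have "I_nbhd X \<mu> (F \<union> G) (min \<epsilon> \<delta>) \<subseteq> I_nbhd X \<mu> F \<epsilon> \<inter> I_nbhd X \<mu> G \<delta>"
        by (auto simp: I_nbhd_def)
      with * show "\<exists>F \<epsilon>. finite F \<and> F \<subseteq> C_fun X \<and> \<epsilon> > 0 \<and> I_nbhd X \<mu> F \<epsilon> \<subseteq> a \<inter> b"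
        by (intro exI[of _ "F \<union> G"] exI[of _ "min \<epsilon> \<delta>"]) auto
    qed
  next
    case (UN K)
    then show ?case by (meson Sup_upper UnionE order_trans)
  next
    case (Basis s)
    then obtain \<mu> F \<epsilon> where s: "s = I_nbhd X \<mu> F \<epsilon>" "finite F" "F \<subseteq> C_fun X" "\<epsilon> > 0"
      by blast
    then show ?case by (metis I_nbhd_shrink)
  qed
  with sub show ?R by blast
next
  assume R: ?R
  show ?L
  proof (subst openin_subopen, intro ballI)
    fix \<mu> assume "\<mu> \<in> U"
    with R obtain F \<epsilon> where *:
      "\<mu> \<in> I_set X" "finite F" "F \<subseteq> C_fun X" "\<epsilon> > 0" "I_nbhd X \<mu> F \<epsilon> \<subseteq> U"
      by blast
    then have "openin (I_top X) (I_nbhd X \<mu> F \<epsilon>)"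
      unfolding I_top_def by (intro topology_generated_by_Basis) blast
    with * show "\<exists>T. openin (I_top X) T \<and> \<mu> \<in> T \<and> T \<subseteq> U"
      by (intro exI[of _ "I_nbhd X \<mu> F \<epsilon>"]) (simp add: I_nbhd_self)
  qed
qed

lemma pullback_in_C_fun:
  assumes "continuous_map X Y f" "\<phi> \<in> C_fun Y"
  shows "restrict (\<phi> \<circ> f) (topspace X) \<in> C_fun X"
proof -
  have "continuous_map X euclideanreal (\<phi> \<circ> f)"
    using assms by (auto simp: C_fun_def intro: continuous_map_compose)
  then show ?thesis
    by (simp add: C_fun_def)
qed

lemma C_const_in_C_fun: "C_const X c \<in> C_fun X"
  by (simp add: C_fun_def C_const_def)

lemma C_odot_in_C_fun: "\<phi> \<in> C_fun X \<Longrightarrow> C_odot X c \<phi> \<in> C_fun X"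
proof -
  assume "\<phi> \<in> C_fun X"
  then have "continuous_map X euclideanreal (\<lambda>x. c + \<phi> x)"
    by (auto simp: C_fun_def intro!: continuous_intros)
  then have "continuous_map X euclideanreal (C_odot X c \<phi>)"
    by (rule continuous_map_eq) (simp add: C_odot_def C_const_def)
  then show ?thesis
    by (simp add: C_fun_def C_odot_def)
qed

lemma C_oplus_in_C_fun: "\<phi> \<in> C_fun X \<Longrightarrow> \<psi> \<in> C_fun X \<Longrightarrow> C_oplus X \<phi> \<psi> \<in> C_fun X"
  by (simp add: C_fun_def C_oplus_def)
     (rule continuous_map_eq[of _ _ "\<lambda>x. max (\<phi> x) (\<psi> x)"],
      auto intro!: continuous_map_real_max)

lemma I_map_in_I_set:
  assumes f: "continuous_map X Y f" and \<mu>: "\<mu> \<in> I_set X"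
  shows "I_map X Y f \<mu> \<in> I_set Y"
proof -
  have fim: "\<And>x. x \<in> topspace X \<Longrightarrow> f x \<in> topspace Y"
    using f by (auto simp: continuous_map_def)
  have 1: "restrict (C_const Y c \<circ> f) (topspace X) = C_const X c" for c
    using fim by (auto simp: C_const_def fun_eq_iff)
  have 2: "restrict (C_odot Y c \<phi> \<circ> f) (topspace X)
      = C_odot X c (restrict (\<phi> \<circ> f) (topspace X))" for c \<phi>
    using fim by (auto simp: C_const_def C_odot_def fun_eq_iff)
  have 3: "restrict (C_oplus Y \<phi> \<psi> \<circ> f) (topspace X)
      = C_oplus X (restrict (\<phi> \<circ> f) (topspace X)) (restrict (\<psi> \<circ> f) (topspace X))" for \<phi> \<psi>
    using fim by (auto simp: C_oplus_def fun_eq_iff)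
  show ?thesis
    using \<mu> pullback_in_C_fun[OF f]
    by (simp add: I_set_def I_map_def idempotent_prob_measure_def C_const_in_C_fun
        C_odot_in_C_fun C_oplus_in_C_fun 1 2 3)
qed

lemma continuous_map_I_map:
  assumes f: "continuous_map X Y f"
  shows "continuous_map (I_top X) (I_top Y) (I_map X Y f)"
  unfolding continuous_map_def
proof (intro conjI allI impI)
  show "I_map X Y f \<in> topspace (I_top X) \<rightarrow> topspace (I_top Y)"
    using I_map_in_I_set[OF f] by auto
  fix U assume U: "openin (I_top Y) U"
  show "openin (I_top X) {\<mu> \<in> topspace (I_top X). I_map X Y f \<mu> \<in> U}"
    unfolding openin_I_top
  proof (intro conjI ballI)
    fix \<mu> assume "\<mu> \<in> {\<mu> \<in> topspace (I_top X). I_map X Y f \<mu> \<in> U}"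
    then obtain F \<epsilon> where *: "finite F" "F \<subseteq> C_fun Y" "\<epsilon> > 0"
        "I_nbhd Y (I_map X Y f \<mu>) F \<epsilon> \<subseteq> U"
      using U unfolding openin_I_top by blast
    let ?G = "(\<lambda>\<phi>. restrict (\<phi> \<circ> f) (topspace X)) ` F"
    have "I_map X Y f \<nu> \<in> I_nbhd Y (I_map X Y f \<mu>) F \<epsilon>" if "\<nu> \<in> I_nbhd X \<mu> ?G \<epsilon>" for \<nu>
      using that *(2) I_map_in_I_set[OF f]
      by (auto simp: I_nbhd_def I_map_def subset_iff)
    then have "I_nbhd X \<mu> ?G \<epsilon> \<subseteq> {\<mu> \<in> topspace (I_top X). I_map X Y f \<mu> \<in> U}"
      using *(4) by (auto simp: I_nbhd_def)
    moreover have "finite ?G" "?G \<subseteq> C_fun X"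
      using * pullback_in_C_fun[OF f] by auto
    ultimately show "\<exists>F \<epsilon>. finite F \<and> F \<subseteq> C_fun X \<and> \<epsilon> > 0 \<and>
        I_nbhd X \<mu> F \<epsilon> \<subseteq> {\<mu> \<in> topspace (I_top X). I_map X Y f \<mu> \<in> U}"
      using *(3) by blast
  qed auto
qed

end

theory Submission
  imports Defs "HOL-Library.Z2" "HOL-Library.Discrete_Functions"
begin

text \<open>
  A trivial \<open>Q\<close>-bundle has many sections that are nowhere equal. The map \<open>f\<close> constructed
  here has infinite fibers, yet any two continuous families \<open>y \<mapsto> s0 y\<close>, \<open>y \<mapsto> s1 y\<close> of idempotent
  measures with \<open>I(f) (s0 y) = I(f) (s1 y) = \<delta>\<^sub>y\<close> coincide somewhere (\<open>lifts_meet\<close>); so \<open>I(f)\<close> is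
  not a trivial \<open>Q\<close>-bundle.

  The example is in the spirit of Dranishnikov's. Let \<open>X = \<Prod>\<^sub>i S\<^sub>i\<close>, where \<open>S\<^sub>i\<close> (coordinates in
  block \<open>i\<close>) is a compact symmetric set avoiding \<open>0\<close> in a space of dimension larger than \<open>2\<^sup>i\<close>. The
  group \<open>(\<int>/2)\<^sup>\<nat>\<close> acts by changing the sign of whole blocks, \<open>Y\<close> is the orbit space, realised by
  the products of pairs of coordinates from the same block, and \<open>f\<close> is the orbit map. It is open
  because it is the orbit map of a group action, and its fibers are Cantor sets.

  Fix \<open>k\<close> and look at the first \<open>k\<close> blocks only. A measure on a fiber then becomes a real function
  on the \<open>2\<^sup>k\<close> sign patterns \<open>p \<subseteq> {..<k}\<close>, with maximum \<open>0\<close>. The Fourier coefficients of the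
  difference of the two functions belonging to \<open>s0\<close> and \<open>s1\<close> are continuous real functions \<open>h\<^sub>c\<close> on
  \<open>X\<close>, one for each character \<open>c\<close> of \<open>(\<int>/2)\<^sup>k\<close>, and \<open>h\<^sub>c\<close> is equivariant: it changes its sign
  according to \<open>c\<close>. A theorem of Borsuk-Ulam type (\<open>equivariant_functions_common_zero\<close>) says that
  the \<open>2\<^sup>k - 1\<close> functions with \<open>c\<close> nontrivial have a common zero \<open>z\<^sub>k\<close>. There the two functions on
  sign patterns differ by a constant, and having the same maximum they are equal. Hence \<open>s0\<close> and \<open>s1\<close>
  agree over \<open>f z\<^sub>k\<close> up to an error that tends to \<open>0\<close> with \<open>k\<close> (\<open>Max_peaks_bounds\<close>,
  \<open>eventually_block_Lipschitz\<close>), and they agree over \<open>f z\<close> for any limit point \<open>z\<close> of the \<open>z\<^sub>k\<close>.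

  The Borsuk-Ulam theorem says that a product of \<open>2\<^sup>k - 1\<close> classes in the first cohomology modulo 2
  of a product of projective spaces is nonzero: the Euler class of the reduced regular
  representation. It is proved on the level of cochains. A cube of dimension \<open>2\<^sup>k - 1\<close>
  with antipodal identifications on its walls maps to \<open>X\<close>, and is triangulated by the flags of a
  cubical grid. Sign functions \<open>g\<^sub>c\<close> on the grid represent the classes, and the
  cup product evaluates to the parity of the number of flags along whose \<open>c\<close>-th edge \<open>g\<^sub>c\<close> changes,
  for every \<open>c\<close>. This parity depends only on the equivariance of the \<open>g\<^sub>c\<close> (\<open>crossing_number_replace\<close>),
  and it is \<open>1\<close> for one particular choice (\<open>crossing_number_model_sign\<close>). Refining the grid gives the
  common zero.
\<close>

section \<open>Flags of a cubical grid\<close>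

lemma bit_add_self [simp]: "(x::bit) + x = 0"
  by (cases x) auto

lemma sum_fixed_point_free_involution:
  fixes F :: "'a \<Rightarrow> bit"
  assumes "finite S"
    and "\<And>w. w \<in> S \<Longrightarrow> \<iota> w \<in> S \<and> \<iota> (\<iota> w) = w \<and> \<iota> w \<noteq> w \<and> F (\<iota> w) = F w"
  shows "sum F S = 0"
  using assms
proof (induction "card S" arbitrary: S rule: less_induct)
  case less
  show ?case
  proof (cases "S = {}")
    case False
    then obtain w where w: "w \<in> S" by auto
    define S' where "S' = S - {w, \<iota> w}"
    have S: "S = insert w (insert (\<iota> w) S')" "w \<notin> insert (\<iota> w) S'" "\<iota> w \<notin> S'" "finite S'"
      using less.prems(1) less.prems(2)[OF w] w by (auto simp: S'_def)
    have "card S' < card S"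
      using less.prems w by (intro psubset_card_mono) (auto simp: S'_def)
    moreover have "\<iota> v \<in> S'" if "v \<in> S'" for v
      using that less.prems(2)[of v] less.prems(2)[of w] w by (auto simp: S'_def)
    ultimately have "sum F S' = 0"
      using less.prems by (intro less.hyps) (auto simp: S'_def)
    moreover have "sum F S = F w + (F (\<iota> w) + sum F S')"
      using S by (metis finite_insert sum.insert)
    ultimately show ?thesis
      using less.prems(2)[OF w] by (simp add: add.assoc [symmetric])
  qed simp
qed

text \<open>
  The sign changes of whole blocks, for a partition of the coordinates into the fibers of \<open>b\<close>. They
  act on grid points (values in \<^typ>\<open>int\<close>) and on points of the cover (values in \<^typ>\<open>real\<close>).
\<close>

definition block_flip :: "(nat \<Rightarrow> nat) \<Rightarrow> nat set \<Rightarrow> (nat \<Rightarrow> 'a) \<Rightarrow> nat \<Rightarrow> 'a::ring_1" where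
  "block_flip b p v = (\<lambda>c. if b c \<in> p then - v c else v c)"

text \<open>
  The grid \<open>{-M..M}\<^sup>N\<close> with \<open>M\<close> odd is cut into cubes of side 2 whose corners have all
  coordinates odd; a point with some even coordinates is the barycentre of a face. A maximal simplex
  of the barycentric subdivision is thus a path from an odd vector \<open>a\<close> to an even vector \<open>e\<close> in which
  every coordinate \<open>c\<close> moves once, by \<open>\<plusminus>1\<close>, at the time \<open>r c\<close>. Unlike the triangulation by monotone
  paths, this one is invariant under \<open>block_flip\<close> together with the order of the vertices, as is
  necessary for evaluating cup products in the quotient. Oddness of \<open>M\<close> makes the walls
  subcomplexes.
\<close>

definition flags :: "nat \<Rightarrow> int \<Rightarrow> ((nat \<Rightarrow> int) \<times> (nat \<Rightarrow> int) \<times> (nat \<Rightarrow> nat)) set" where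
  "flags N M = {(a, e, r). r permutes {1..N} \<and>
     (\<forall>c\<in>{1..N}. odd (a c) \<and> \<bar>a c\<bar> \<le> M \<and> \<bar>e c\<bar> \<le> M \<and> \<bar>e c - a c\<bar> = 1) \<and>
     (\<forall>c. c \<notin> {1..N} \<longrightarrow> a c = 0 \<and> e c = 0)}"

definition vertex :: "(nat \<Rightarrow> int) \<times> (nat \<Rightarrow> int) \<times> (nat \<Rightarrow> nat) \<Rightarrow> nat \<Rightarrow> nat \<Rightarrow> int" where
  "vertex w l = (case w of (a, e, r) \<Rightarrow> (\<lambda>c. if r c \<le> l then e c else a c))"

definition on_wall :: "nat \<Rightarrow> int \<Rightarrow> (nat \<Rightarrow> nat) \<Rightarrow> nat \<Rightarrow> (nat \<Rightarrow> int) \<Rightarrow> bool" where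
  "on_wall N M b i v \<longleftrightarrow> (\<exists>c\<in>{1..N}. b c = i \<and> \<bar>v c\<bar> = M)"

lemma finite_flags: "finite (flags N M)"
proof -
  let ?V = "{f::nat \<Rightarrow> int. \<forall>x. (x \<in> {1..N} \<longrightarrow> f x \<in> {-M..M}) \<and> (x \<notin> {1..N} \<longrightarrow> f x = 0)}"
  have "finite ?V"
    by (rule finite_set_of_finite_funs) auto
  then have "finite (?V \<times> ?V \<times> {r. r permutes {1..N}})"
    by (intro finite_SigmaI finite_permutations) auto
  moreover have "flags N M \<subseteq> ?V \<times> ?V \<times> {r. r permutes {1..N}}"
    by (auto simp: flags_def abs_le_iff minus_le_iff)
  ultimately show ?thesis
    by (rule rev_finite_subset)
qed

lemma flags_update_first:
  assumes "(a, e, r) \<in> flags N M" "c \<in> {1..N}" "odd x" "\<bar>x\<bar> \<le> M" "\<bar>e c - x\<bar> = 1"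
  shows "(a(c := x), e, r) \<in> flags N M"
  using assms by (simp add: flags_def)

lemma flags_update_last:
  assumes "(a, e, r) \<in> flags N M" "c \<in> {1..N}" "\<bar>x\<bar> \<le> M" "\<bar>x - a c\<bar> = 1"
  shows "(a, e(c := x), r) \<in> flags N M"
  using assms by (simp add: flags_def)

text \<open>
  The flags form a cycle modulo 2 once antipodal points of the walls are identified: a quantity that
  ignores the vertex \<open>l\<close> takes the same value on two flags that share the face opposite to
  \<open>l\<close>. The involution that exchanges them reflects the first vertex
  (\<open>l = 0\<close>), swaps two consecutive moves (\<open>0 < l < N\<close>) or reflects the last vertex (\<open>l = N\<close>). In the
  last case the reflected vertex can leave the cube; the face then lies in a wall, and its
  partner is the flag flipped by the identification of that wall.
\<close>

lemma sum_flags_eq_0: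
  fixes F :: "(nat \<Rightarrow> nat \<Rightarrow> int) \<Rightarrow> bit"
  assumes M: "odd M" and l: "l \<le> N" "0 < N"
    and indep: "\<And>u u'. (\<And>m. m \<le> N \<Longrightarrow> m \<noteq> l \<Longrightarrow> u m = u' m) \<Longrightarrow> F u = F u'"
    and wall: "\<And>u i. l = N \<Longrightarrow> (\<And>m. m < N \<Longrightarrow> on_wall N M b i (u m)) \<Longrightarrow>
                 F (\<lambda>m. block_flip b {i} (u m)) = F u"
  shows "(\<Sum>w\<in>flags N M. F (vertex w)) = 0"
proof -
  consider (first) "l = 0" | (mid) "1 \<le> l" "l < N" | (last) "l = N" using l by linarith
  then show ?thesis
  proof cases
    case first
    define \<iota> where "\<iota> = (\<lambda>(a::nat \<Rightarrow> int, e::nat \<Rightarrow> int, r::nat \<Rightarrow> nat).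
       (a(inv r (Suc 0) := 2 * e (inv r (Suc 0)) - a (inv r (Suc 0))), e, r))"
    show ?thesis
    proof (rule sum_fixed_point_free_involution[where \<iota> = \<iota>, OF finite_flags])
      fix w assume w: "w \<in> flags N M"
      obtain a e r where aer: "w = (a, e, r)" by (cases w)
      define c where "c = inv r (Suc 0)"
      have r: "r permutes {1..N}" using w by (simp add: aer flags_def)
      then have rc: "r c = 1" by (simp add: c_def permutes_inverses)
      have c: "c \<in> {1..N}" using r rc l by (metis atLeastAtMost_iff permutes_in_image Suc_leI One_nat_def order_refl)
      have ac: "odd (a c)" "\<bar>a c\<bar> \<le> M" "\<bar>e c\<bar> \<le> M" "\<bar>e c - a c\<bar> = 1"
        using w c by (auto simp: aer flags_def)
      have "e c = a c + 1 \<or> e c = a c - 1" using ac(4) by linarith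
      then have ec: "even (e c)" using ac(1) by auto
      then have "\<bar>e c\<bar> \<noteq> M" using M by (metis dvd_abs_iff)
      then have bd: "\<bar>2 * e c - a c\<bar> \<le> M" using ac by linarith
      have 1: "\<iota> (a, e, r) = (a(c := 2 * e c - a c), e, r)" by (simp add: \<iota>_def aer c_def)
      have 2: "\<iota> w \<in> flags N M"
        using w unfolding aer 1
        by (rule flags_update_first [OF _ c]) (use ac ec bd in \<open>auto simp: abs_minus_commute\<close>)
      have 3: "\<iota> (\<iota> w) = w"
        by (simp add: 1 aer) (simp add: \<iota>_def aer c_def [symmetric])
      have 4: "\<iota> w \<noteq> w" using ac by (auto simp: 1 aer fun_eq_iff)
      have "F (vertex (\<iota> w)) = F (vertex w)"
        by (rule indep) (use first rc in \<open>auto simp: 1 aer vertex_def fun_eq_iff\<close>)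
      with 2 3 4 show "\<iota> w \<in> flags N M \<and> \<iota> (\<iota> w) = w \<and> \<iota> w \<noteq> w \<and> F (vertex (\<iota> w)) = F (vertex w)"
        by blast
    qed
  next
    case mid
    define \<iota> where "\<iota> = (\<lambda>(a::nat \<Rightarrow> int, e::nat \<Rightarrow> int, r::nat \<Rightarrow> nat). (a, e, Transposition.transpose l (Suc l) \<circ> r))"
    show ?thesis
    proof (rule sum_fixed_point_free_involution[where \<iota> = \<iota>, OF finite_flags])
      fix w assume w: "w \<in> flags N M"
      obtain a e r where aer: "w = (a, e, r)" by (cases w)
      have r: "r permutes {1..N}" using w by (simp add: aer flags_def)
      have 1: "\<iota> (a, e, r) = (a, e, Transposition.transpose l (Suc l) \<circ> r)" by (simp add: \<iota>_def)
      have 2: "\<iota> w \<in> flags N M"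
        using w mid permutes_compose[OF r permutes_swap_id[of l "{1..N}" "Suc l"]]
        by (auto simp: 1 aer flags_def)
      have 3: "\<iota> (\<iota> w) = w"
        by (simp add: 1 aer) (simp add: \<iota>_def aer fun_eq_iff)
      have "r (inv r l) = l" using r by (simp add: permutes_inverses)
      then have "Transposition.transpose l (Suc l) (r (inv r l)) \<noteq> r (inv r l)" by simp
      then have 4: "\<iota> w \<noteq> w" by (auto simp: 1 aer fun_eq_iff)
      have "F (vertex (\<iota> w)) = F (vertex w)"
        by (rule indep) (auto simp: 1 aer vertex_def fun_eq_iff Transposition.transpose_def)
      with 2 3 4 show "\<iota> w \<in> flags N M \<and> \<iota> (\<iota> w) = w \<and> \<iota> w \<noteq> w \<and> F (vertex (\<iota> w)) = F (vertex w)"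
        by blast
    qed
  next
    case last
    define \<iota> where "\<iota> = (\<lambda>(a::nat \<Rightarrow> int, e::nat \<Rightarrow> int, r::nat \<Rightarrow> nat).
       let c = inv r N in
       if \<bar>a c\<bar> < M then (a, e(c := 2 * a c - e c), r)
       else (block_flip b {b c} a, block_flip b {b c} e, r))"
    show ?thesis
    proof (rule sum_fixed_point_free_involution[where \<iota> = \<iota>, OF finite_flags])
      fix w assume w: "w \<in> flags N M"
      obtain a e r where aer: "w = (a, e, r)" by (cases w)
      define c where "c = inv r N"
      have r: "r permutes {1..N}" using w by (simp add: aer flags_def)
      then have rc: "r c = N" by (simp add: c_def permutes_inverses)
      have c: "c \<in> {1..N}" using r rc l by (metis atLeastAtMost_iff permutes_in_image Suc_leI One_nat_def order_refl)
      have ac: "odd (a c)" "\<bar>a c\<bar> \<le> M" "\<bar>e c\<bar> \<le> M" "\<bar>e c - a c\<bar> = 1"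
        using w c by (auto simp: aer flags_def)
      have rN: "r d \<le> N" if "d \<in> {1..N}" for d using permutes_in_image[OF r, of d] that by auto
      show "\<iota> w \<in> flags N M \<and> \<iota> (\<iota> w) = w \<and> \<iota> w \<noteq> w \<and> F (vertex (\<iota> w)) = F (vertex w)"
      proof (cases "\<bar>a c\<bar> < M")
        case True
        have 1: "\<iota> (a, e, r) = (a, e(c := 2 * a c - e c), r)" using True by (simp add: \<iota>_def aer c_def Let_def)
        have bd: "\<bar>2 * a c - e c\<bar> \<le> M" using ac True by linarith
        have 2: "\<iota> w \<in> flags N M"
          using w unfolding aer 1
          by (rule flags_update_last [OF _ c]) (use ac bd in \<open>auto simp: abs_minus_commute\<close>)
        have 3: "\<iota> (\<iota> w) = w"
          using True by (simp add: 1 aer) (simp add: \<iota>_def aer c_def [symmetric])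
        have 4: "\<iota> w \<noteq> w" using ac by (auto simp: 1 aer fun_eq_iff)
        have "F (vertex (\<iota> w)) = F (vertex w)"
          by (rule indep) (use last rc in \<open>auto simp: 1 aer vertex_def fun_eq_iff\<close>)
        with 2 3 4 show ?thesis by blast
      next
        case False
        then have acM: "\<bar>a c\<bar> = M" using ac by simp
        have 1: "\<iota> (a, e, r) = (block_flip b {b c} a, block_flip b {b c} e, r)"
          using False by (simp add: \<iota>_def aer c_def Let_def)
        have 2: "\<iota> w \<in> flags N M"
          using w by (fastforce simp: 1 aer flags_def block_flip_def)
        have 3: "\<iota> (\<iota> w) = w"
          using False by (simp add: 1 aer) (simp add: \<iota>_def aer c_def [symmetric] block_flip_def fun_eq_iff)
        have "block_flip b {b c} a c \<noteq> a c" using ac by (auto simp: block_flip_def)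
        then have 4: "\<iota> w \<noteq> w" by (auto simp: 1 aer)
        have "vertex (\<iota> w) = (\<lambda>m. block_flip b {b c} (vertex w m))"
          by (auto simp: 1 aer vertex_def fun_eq_iff block_flip_def)
        moreover have "F (\<lambda>m. block_flip b {b c} (vertex w m)) = F (vertex w)"
        proof (rule wall[OF last])
          fix m assume "m < N"
          then have "vertex w m c = a c" using rc by (simp add: aer vertex_def)
          then show "on_wall N M b (b c) (vertex w m)"
            using c acM by (auto simp: on_wall_def)
        qed
        ultimately show ?thesis using 2 3 4 by simp
      qed
    qed
  qed
qed

section \<open>Parity of crossings\<close>

lemma bit_add_eq_0_iff: "(x::bit) + y = 0 \<longleftrightarrow> x = y"
  by (cases x; cases y) auto

lemma shift_left_identity:
  fixes l :: "'a::comm_semiring"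
  shows "l * k * d * r * (x + y) = l * (y * k) * d * r + (l * x) * k * d * r"
  by (simp add: algebra_simps)

lemma shift_right_identity:
  fixes l :: "'a::comm_semiring"
  shows "l * d * k * r * (x + y) = l * d * k * (y * r) + l * d * (x * k) * r"
  by (simp add: algebra_simps)

lemma replace_identity:
  fixes l :: "'a::comm_semiring"
  shows "(x + y) * (l * r) + (u + v) * (l * r) = l * ((u + x) + (v + y)) * r"
  by (simp add: algebra_simps)

lemma sum_eq_if_split_sum_eq_0:
  fixes F :: "'b \<Rightarrow> bit"
  assumes "(\<Sum>w\<in>S. F (h w)) = 0" and "\<And>u. F u = A u + B u"
  shows "(\<Sum>w\<in>S. A (h w)) = (\<Sum>w\<in>S. B (h w))"
  using assms(1) unfolding assms(2) sum.distrib bit_add_eq_0_iff .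

text \<open>
  The cocycle of the double cover on which \<open>g\<close> is a sign function: \<open>1\<close> on the edges where \<open>g\<close> changes.
\<close>

definition jump :: "('v \<Rightarrow> bit) \<Rightarrow> 'v \<Rightarrow> 'v \<Rightarrow> bit" where
  "jump g u v = g u + g v"

lemma jump_add: "jump g u v + jump g v w = jump g u w"
  by (cases "g u"; cases "g v"; cases "g w") (simp_all add: jump_def)

text \<open>
  A cup product with a coboundary as its \<open>j\<close>-th factor, evaluated on a cycle, vanishes. The two
  terms of the coboundary \<open>d (w (j-1)) + d (w j)\<close> are treated separately. In the term with \<open>d (w j)\<close>
  the edges of the factors before \<open>j\<close> are moved one step up, one after the other beginning with the
  factor \<open>j - 1\<close>; by the cocycle identity each move changes the summand by a quantity that ignores
  one vertex, so \<open>sum_flags_eq_0\<close> leaves the sum unchanged. In the end nothing depends on vertex \<open>0\<close>.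
  In the term with \<open>d (w (j-1))\<close> the later factors are moved down, and in the end nothing
  depends on vertex \<open>N\<close>. The invariance of \<open>d\<close> and of the cocycles is needed for the walls.
\<close>

lemma sum_flags_coboundary_eq_0:
  fixes g :: "nat \<Rightarrow> (nat \<Rightarrow> int) \<Rightarrow> bit"
  assumes M: "odd M" and j: "j \<in> {1..N}"
    and d: "\<And>i v. on_wall N M b i v \<Longrightarrow> d (block_flip b {i} v) = d v"
    and g: "\<And>c i v. c \<in> {1..N} \<Longrightarrow> on_wall N M b i v \<Longrightarrow> g c (block_flip b {i} v) = g c v + \<epsilon> c i"
  shows "(\<Sum>w\<in>flags N M. (\<Prod>i\<in>{1..<j}. jump (g i) (vertex w (i-1)) (vertex w i)) *
            jump d (vertex w (j-1)) (vertex w j) *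
            (\<Prod>i\<in>{j<..N}. jump (g i) (vertex w (i-1)) (vertex w i))) = 0"
proof -
  have N: "0 < N" using j by simp
  \<comment> \<open>unprimed: factors at their original edges; primed: factors whose edges are shifted by one\<close>
  define L where "L m u = (\<Prod>i\<in>{1..m}. jump (g i) (u (i-1)) (u i))" for m and u :: "nat \<Rightarrow> nat \<Rightarrow> int"
  define L' where "L' m u = (\<Prod>i\<in>{m<..<j}. jump (g i) (u i) (u (Suc i)))" for m and u :: "nat \<Rightarrow> nat \<Rightarrow> int"
  define R where "R m u = (\<Prod>i\<in>{m<..N}. jump (g i) (u (i-1)) (u i))" for m and u :: "nat \<Rightarrow> nat \<Rightarrow> int"
  define R' where "R' m u = (\<Prod>i\<in>{j<..m}. jump (g i) (u (i-2)) (u (i-1)))" for m and u :: "nat \<Rightarrow> nat \<Rightarrow> int"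
  have left_step: "(\<Sum>w\<in>flags N M. L m (vertex w) * L' m (vertex w) * d (vertex w j) * R j (vertex w)) =
      (\<Sum>w\<in>flags N M. L (Suc m) (vertex w) * L' (Suc m) (vertex w) * d (vertex w j) * R j (vertex w))"
    if m: "Suc m < j" for m
  proof -
    have "(\<Sum>w\<in>flags N M. (\<lambda>u. L m u * L' (Suc m) u * d (u j) * R j u * jump (g (Suc m)) (u m) (u (m + 2)))
       (vertex w)) = 0"
    proof (rule sum_flags_eq_0[OF M, where l = "Suc m"])
      fix u u' :: "nat \<Rightarrow> nat \<Rightarrow> int" assume E: "\<And>x. x \<le> N \<Longrightarrow> x \<noteq> Suc m \<Longrightarrow> u x = u' x"
      have "L m u = L m u'" "L' (Suc m) u = L' (Suc m) u'" "R j u = R j u'"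
        unfolding L_def L'_def R_def using m j by (auto intro!: prod.cong simp: E)
      moreover have "u j = u' j" "u m = u' m" "u (m+2) = u' (m+2)" using m j by (auto intro!: E)
      ultimately show "L m u * L' (Suc m) u * d (u j) * R j u * jump (g (Suc m)) (u m) (u (m + 2)) =
         L m u' * L' (Suc m) u' * d (u' j) * R j u' * jump (g (Suc m)) (u' m) (u' (m + 2))" by simp
    qed (use m j N in auto)
    moreover have "L m u * L' (Suc m) u * d (u j) * R j u * jump (g (Suc m)) (u m) (u (m + 2)) =
       L m u * L' m u * d (u j) * R j u + L (Suc m) u * L' (Suc m) u * d (u j) * R j u" for u
    proof -
      have 1: "L (Suc m) u = L m u * jump (g (Suc m)) (u m) (u (Suc m))"
        by (simp add: L_def)
      have "{m<..<j} = insert (Suc m) {Suc m<..<j}" using m by auto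
      then have 2: "L' m u = jump (g (Suc m)) (u (Suc m)) (u (m+2)) * L' (Suc m) u"
        by (simp add: L'_def)
      have 3: "jump (g (Suc m)) (u m) (u (m + 2)) =
        jump (g (Suc m)) (u m) (u (Suc m)) + jump (g (Suc m)) (u (Suc m)) (u (m+2))"
        by (rule jump_add [symmetric])
      show ?thesis unfolding 1 2 3 by (rule shift_left_identity)
    qed
    ultimately show ?thesis
      by (rule sum_eq_if_split_sum_eq_0)
  qed
  have right_step: "(\<Sum>w\<in>flags N M. L (j-1) (vertex w) * d (vertex w (j-1)) * R' m (vertex w) * R m (vertex w)) =
      (\<Sum>w\<in>flags N M. L (j-1) (vertex w) * d (vertex w (j-1)) * R' (Suc m) (vertex w) * R (Suc m) (vertex w))"
    if m: "j \<le> m" "m < N" for m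
  proof -
    have "(\<Sum>w\<in>flags N M. (\<lambda>u. L (j-1) u * d (u (j-1)) * R' m u * R (Suc m) u * jump (g (Suc m)) (u (m-1)) (u (Suc m)))
       (vertex w)) = 0"
    proof (rule sum_flags_eq_0[OF M, where l = "m"])
      fix u u' :: "nat \<Rightarrow> nat \<Rightarrow> int" assume E: "\<And>x. x \<le> N \<Longrightarrow> x \<noteq> m \<Longrightarrow> u x = u' x"
      have "L (j-1) u = L (j-1) u'" "R' m u = R' m u'" "R (Suc m) u = R (Suc m) u'"
        unfolding L_def R'_def R_def using m j by (auto intro!: prod.cong simp: E)
      moreover have "u (j-1) = u' (j-1)" "u (m-1) = u' (m-1)" "u (Suc m) = u' (Suc m)" using m j by (auto intro!: E)
      ultimately show "L (j-1) u * d (u (j-1)) * R' m u * R (Suc m) u * jump (g (Suc m)) (u (m-1)) (u (Suc m)) =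
         L (j-1) u' * d (u' (j-1)) * R' m u' * R (Suc m) u' * jump (g (Suc m)) (u' (m-1)) (u' (Suc m))" by simp
    qed (use m j N in auto)
    moreover have "L (j-1) u * d (u (j-1)) * R' m u * R (Suc m) u * jump (g (Suc m)) (u (m-1)) (u (Suc m)) =
       L (j-1) u * d (u (j-1)) * R' m u * R m u + L (j-1) u * d (u (j-1)) * R' (Suc m) u * R (Suc m) u" for u
    proof -
      have "{m<..N} = insert (Suc m) {Suc m<..N}" using m by auto
      then have 1: "R m u = jump (g (Suc m)) (u m) (u (Suc m)) * R (Suc m) u"
        by (simp add: R_def)
      have "{j<..Suc m} = insert (Suc m) {j<..m}" using m by auto
      then have 2: "R' (Suc m) u = jump (g (Suc m)) (u (m-1)) (u m) * R' m u"
        by (simp add: R'_def numeral_2_eq_2)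
      have 3: "jump (g (Suc m)) (u (m-1)) (u (Suc m)) =
        jump (g (Suc m)) (u (m-1)) (u m) + jump (g (Suc m)) (u m) (u (Suc m))"
        by (rule jump_add [symmetric])
      show ?thesis unfolding 1 2 3 by (rule shift_right_identity)
    qed
    ultimately show ?thesis
      by (rule sum_eq_if_split_sum_eq_0)
  qed
  have "(\<Sum>w\<in>flags N M. L (j-1) (vertex w) * d (vertex w j) * R j (vertex w)) = 0"
  proof -
    have "(\<Sum>w\<in>flags N M. L 0 (vertex w) * L' 0 (vertex w) * d (vertex w j) * R j (vertex w)) =
      (\<Sum>w\<in>flags N M. L m (vertex w) * L' m (vertex w) * d (vertex w j) * R j (vertex w))" if "m < j" for m
      using that
    proof (induction m)
      case (Suc m)
      from Suc.prems have "m < j" by simp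
      then show ?case by (rule trans [OF Suc.IH left_step [OF Suc.prems]])
    qed (rule refl)
    note this[of "j - 1"]
    moreover have "j - 1 < j" and "{j-1<..<j} = {}" using j by auto
    moreover from this have "L 0 u = 1" "L' (j-1) u = 1" for u by (simp_all add: L_def L'_def)
    ultimately have "(\<Sum>w\<in>flags N M. L (j-1) (vertex w) * d (vertex w j) * R j (vertex w)) =
       (\<Sum>w\<in>flags N M. (\<lambda>u. L' 0 u * d (u j) * R j u) (vertex w))"
      by (simp only: mult_1_left mult_1_right simp_thms)
    also have "\<dots> = 0"
    proof (rule sum_flags_eq_0[OF M, where l = 0])
      fix u u' :: "nat \<Rightarrow> nat \<Rightarrow> int" assume E: "\<And>x. x \<le> N \<Longrightarrow> x \<noteq> 0 \<Longrightarrow> u x = u' x"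
      have "L' 0 u = L' 0 u'" "R j u = R j u'"
        unfolding L'_def R_def using j by (auto intro!: prod.cong simp: E)
      moreover have "u j = u' j" using j by (auto intro!: E)
      ultimately show "L' 0 u * d (u j) * R j u = L' 0 u' * d (u' j) * R j u'" by simp
    qed (use N in auto)
    finally show ?thesis .
  qed
  moreover have "(\<Sum>w\<in>flags N M. L (j-1) (vertex w) * d (vertex w (j-1)) * R j (vertex w)) = 0"
  proof -
    have "(\<Sum>w\<in>flags N M. L (j-1) (vertex w) * d (vertex w (j-1)) * R' j (vertex w) * R j (vertex w)) =
      (\<Sum>w\<in>flags N M. L (j-1) (vertex w) * d (vertex w (j-1)) * R' m (vertex w) * R m (vertex w))"
      if "j \<le> m" "m \<le> N" for m
      using that
    proof (induction m rule: dec_induct)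
      case (step m)
      from step.prems have "m < N" "m \<le> N" by auto
      from step.IH [OF this(2)] right_step [OF step.hyps(1) this(1)] show ?case by (rule trans)
    qed (rule refl)
    note this[of N]
    moreover have "j \<le> N" "N \<le> N" using j by auto
    moreover have "R' j u = 1" "R N u = 1" for u by (simp_all add: R_def R'_def)
    ultimately have "(\<Sum>w\<in>flags N M. L (j-1) (vertex w) * d (vertex w (j-1)) * R j (vertex w)) =
       (\<Sum>w\<in>flags N M. (\<lambda>u. L (j-1) u * d (u (j-1)) * R' N u) (vertex w))"
      by (simp only: mult_1_left mult_1_right simp_thms)
    also have "\<dots> = 0"
    proof (rule sum_flags_eq_0[OF M, where l = N])
      fix u u' :: "nat \<Rightarrow> nat \<Rightarrow> int" assume E: "\<And>x. x \<le> N \<Longrightarrow> x \<noteq> N \<Longrightarrow> u x = u' x"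
      have "L (j-1) u = L (j-1) u'" "R' N u = R' N u'"
        unfolding L_def R'_def using j by (auto intro!: prod.cong simp: E)
      moreover have "u (j-1) = u' (j-1)" using j by (auto intro!: E)
      ultimately show "L (j-1) u * d (u (j-1)) * R' N u = L (j-1) u' * d (u' (j-1)) * R' N u'" by simp
    next
      fix u :: "nat \<Rightarrow> nat \<Rightarrow> int" and i assume W: "\<And>m. m < N \<Longrightarrow> on_wall N M b i (u m)"
      let ?u = "\<lambda>m. block_flip b {i} (u m)"
      have "jump (g c) (?u x) (?u y) = jump (g c) (u x) (u y)" if "c \<in> {1..N}" "x < N" "y < N" for c x y
        unfolding jump_def g[OF that(1) W[OF that(2)]] g[OF that(1) W[OF that(3)]]
        by (cases "\<epsilon> c i"; cases "g c (u x)"; cases "g c (u y)") simp_all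
      then have "L (j-1) ?u = L (j-1) u" "R' N ?u = R' N u"
        unfolding L_def R'_def using j by (auto intro!: prod.cong)
      moreover have "d (?u (j-1)) = d (u (j-1))" using j by (intro d W) auto
      ultimately show "L (j-1) ?u * d (?u (j-1)) * R' N ?u = L (j-1) u * d (u (j-1)) * R' N u" by simp
    qed (use N in auto)
    finally show ?thesis .
  qed
  moreover have "(\<Prod>i\<in>{1..<j}. jump (g i) (u (i-1)) (u i)) * jump d (u (j-1)) (u j) *
            (\<Prod>i\<in>{j<..N}. jump (g i) (u (i-1)) (u i)) = L (j-1) u * d (u (j-1)) * R j u + L (j-1) u * d (u j) * R j u" for u
  proof -
    have "{1..<j} = {1..j-1}" using j by auto
    then show ?thesis unfolding L_def R_def by (simp only: jump_def [of d] distrib_left distrib_right)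
  qed
  ultimately show ?thesis by (simp only: sum.distrib add_0_left)
qed

definition crossing_number :: "nat \<Rightarrow> int \<Rightarrow> (nat \<Rightarrow> (nat \<Rightarrow> int) \<Rightarrow> bit) \<Rightarrow> bit" where
  "crossing_number N M g = (\<Sum>w\<in>flags N M. \<Prod>c\<in>{1..N}. jump (g c) (vertex w (c-1)) (vertex w c))"

text \<open>
  Two sign functions of the same equivariance differ by a function on the quotient, so their
  cocycles differ by a coboundary.
\<close>

lemma crossing_number_replace1:
  assumes M: "odd M" and j: "j \<in> {1..N}"
    and g: "\<And>c i v. c \<in> {1..N} \<Longrightarrow> on_wall N M b i v \<Longrightarrow> g c (block_flip b {i} v) = g c v + \<epsilon> c i"
    and h: "\<And>i v. on_wall N M b i v \<Longrightarrow> h (block_flip b {i} v) = h v + \<epsilon> j i"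
  shows "crossing_number N M (g(j := h)) = crossing_number N M g"
proof -
  define d where "d v = g j v + h v" for v
  have dinv: "d (block_flip b {i} v) = d v" if "on_wall N M b i v" for i v
    unfolding d_def g[OF j that] h[OF that] by (cases "\<epsilon> j i"; cases "g j v"; cases "h v") simp_all
  have S: "{1..N} = insert j ({1..<j} \<union> {j<..N})" "j \<notin> {1..<j} \<union> {j<..N}" using j by auto
  have prod_split: "(\<Prod>c\<in>{1..N}. f c) = f j * ((\<Prod>c\<in>{1..<j}. f c) * (\<Prod>c\<in>{j<..N}. f c))" for f :: "nat \<Rightarrow> bit"
    by (subst S(1), subst prod.insert, simp, simp, subst prod.union_disjoint) auto
  have prod_upd: "(\<Prod>i\<in>{1..<j}. f ((g(j := h)) i) i) = (\<Prod>i\<in>{1..<j}. f (g i) i)"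
      "(\<Prod>i\<in>{j<..N}. f ((g(j := h)) i) i) = (\<Prod>i\<in>{j<..N}. f (g i) i)"
    for f :: "((nat \<Rightarrow> int) \<Rightarrow> bit) \<Rightarrow> nat \<Rightarrow> bit"
    by (auto intro!: prod.cong)
  have upd: "(\<Prod>c\<in>{1..N}. jump ((g(j := h)) c) (u (c-1)) (u c)) + (\<Prod>c\<in>{1..N}. jump (g c) (u (c-1)) (u c)) =
     (\<Prod>i\<in>{1..<j}. jump (g i) (u (i-1)) (u i)) * jump d (u (j-1)) (u j) *
            (\<Prod>i\<in>{j<..N}. jump (g i) (u (i-1)) (u i))" for u
    unfolding prod_split
      prod_upd [of "\<lambda>x i. jump x (u (i-1)) (u i)"]
    by (simp only: jump_def d_def fun_upd_same replace_identity)
  have "crossing_number N M (g(j := h)) + crossing_number N M g = 0"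
    unfolding crossing_number_def sum.distrib [symmetric] upd
    by (rule sum_flags_coboundary_eq_0[OF M j, of b d g \<epsilon>]) (use dinv g in auto)
  then show ?thesis
    by (cases "crossing_number N M g"; cases "crossing_number N M (g(j := h))") auto
qed

lemma crossing_number_replace:
  assumes M: "odd M"
    and g: "\<And>c i v. c \<in> {1..N} \<Longrightarrow> on_wall N M b i v \<Longrightarrow> g c (block_flip b {i} v) = g c v + \<epsilon> c i"
    and h: "\<And>c i v. c \<in> {1..N} \<Longrightarrow> on_wall N M b i v \<Longrightarrow> h c (block_flip b {i} v) = h c v + \<epsilon> c i"
  shows "crossing_number N M g = crossing_number N M h"
proof -
  have upto: "crossing_number N M (\<lambda>c. if c \<le> n then h c else g c) = crossing_number N M g" if "n \<le> N" for n
    using that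
  proof (induction n)
    case 0
    show ?case unfolding crossing_number_def by (intro sum.cong prod.cong) auto
  next
    case (Suc n)
    have "crossing_number N M ((\<lambda>c. if c \<le> n then h c else g c)(Suc n := h (Suc n))) =
       crossing_number N M (\<lambda>c. if c \<le> n then h c else g c)"
      by (rule crossing_number_replace1[OF M, where b = b and \<epsilon> = \<epsilon>]) (use Suc g h in auto)
    moreover have "(\<lambda>c. if c \<le> n then h c else g c)(Suc n := h (Suc n)) = (\<lambda>c. if c \<le> Suc n then h c else g c)"
      by (auto simp: fun_eq_iff le_Suc_eq)
    ultimately show ?case using Suc by simp
  qed
  have "crossing_number N M g = crossing_number N M (\<lambda>c. if c \<le> N then h c else g c)"
    by (rule upto [OF order_refl, symmetric])
  also have "\<dots> = crossing_number N M h"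
    unfolding crossing_number_def by (intro sum.cong prod.cong) auto
  finally show ?thesis .
qed

section \<open>Evaluation for a model\<close>

text \<open>
  From now on the block of the coordinate \<open>c \<ge> 1\<close> is \<^term>\<open>floor_log c\<close>, the highest binary digit of
  \<open>c\<close>. At the same time \<open>c\<close> encodes a character of \<open>(\<int>/2)\<^sup>k\<close> by its binary digits; so block \<open>i\<close>
  consists of the \<open>2\<^sup>i\<close> characters that are nontrivial on the \<open>i\<close>-th factor and trivial on all later ones.
\<close>

definition lead_sign :: "nat \<Rightarrow> (nat \<Rightarrow> int) \<Rightarrow> bit" where
  "lead_sign i v = (if \<exists>c. floor_log c = i \<and> v c \<noteq> 0
     then of_bool (v (LEAST c. floor_log c = i \<and> v c \<noteq> 0) < 0) else 0)"

text \<open>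
  Morally \<open>model_sign c v\<close> is the sign of \<open>v c\<close> times a sign function for each lower digit of \<open>c\<close>. For
  \<open>v c = 0\<close> the sign of \<open>v c\<close> is replaced by \<^term>\<open>lead_sign (floor_log c) v\<close>, to be odd on
  the walls of the block; the summand for the highest digit of \<open>c\<close> cancels or provides this value.
\<close>

definition model_sign :: "nat \<Rightarrow> (nat \<Rightarrow> int) \<Rightarrow> bit" where
  "model_sign c v = (if v c \<noteq> 0 then of_bool (v c < 0) + lead_sign (floor_log c) v else 0) +
     (\<Sum>i | i \<le> floor_log c \<and> bit c i. lead_sign i v)"

lemma bit_imp_le_floor_log: "bit c i \<Longrightarrow> i \<le> floor_log c"
proof -
  assume "bit c i"
  then have "c div 2 ^ i \<noteq> 0" by (metis bit_iff_odd even_zero)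
  then have "2 ^ i \<le> c" by (metis div_less not_less)
  then show ?thesis using floor_log_mono[THEN monoD, of "2 ^ i" c] by simp
qed

lemma bit_floor_log: "c \<noteq> 0 \<Longrightarrow> bit c (floor_log c)"
proof -
  assume c: "c \<noteq> 0"
  have "2 ^ floor_log c \<le> c" "c < 2 * 2 ^ floor_log c"
    using c floor_log_exp2_le floor_log_exp2_gt by auto
  then have "c div 2 ^ floor_log c = 1" by (intro div_nat_eqI) auto
  then show ?thesis by (simp add: bit_iff_odd)
qed

lemma floor_log_Suc_even: "even c \<Longrightarrow> c \<noteq> 0 \<Longrightarrow> floor_log (Suc c) = floor_log c"
  by (elim evenE) (simp add: floor_log_rec[of "Suc (2 * _)"])

lemma lead_sign_block_flip_same:
  assumes "floor_log c = i" "v c \<noteq> 0"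
  shows "lead_sign i (block_flip floor_log {i} v) = lead_sign i v + 1"
proof -
  define m where "m = (LEAST c. floor_log c = i \<and> v c \<noteq> 0)"
  have m: "floor_log m = i \<and> v m \<noteq> 0" unfolding m_def by (rule LeastI2[of _ c]) (use assms in auto)
  have "(\<lambda>c. floor_log c = i \<and> block_flip floor_log {i} v c \<noteq> 0) = (\<lambda>c. floor_log c = i \<and> v c \<noteq> 0)"
    by (auto simp: block_flip_def fun_eq_iff)
  then have "lead_sign i (block_flip floor_log {i} v) = of_bool (- v m < 0)"
    using m unfolding lead_sign_def by (auto simp: m_def [symmetric] block_flip_def)
  moreover have "lead_sign i v = of_bool (v m < 0)"
    using m unfolding lead_sign_def by (auto simp: m_def [symmetric])
  ultimately show ?thesis using m by (cases "v m < 0") auto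
qed

lemma lead_sign_block_flip_other:
  assumes "j \<noteq> i"
  shows "lead_sign j (block_flip floor_log {i} v) = lead_sign j v"
proof -
  have eq: "(\<lambda>c. floor_log c = j \<and> block_flip floor_log {i} v c \<noteq> 0) = (\<lambda>c. floor_log c = j \<and> v c \<noteq> 0)"
    using assms by (auto simp: block_flip_def fun_eq_iff)
  have "floor_log (LEAST c. floor_log c = j \<and> v c \<noteq> 0) = j" if "\<exists>c. floor_log c = j \<and> v c \<noteq> 0"
    using that by (rule LeastI2_ex) auto
  then show ?thesis using assms unfolding lead_sign_def eq by (auto simp: block_flip_def)
qed

lemma model_sign_block_flip:
  assumes wall: "on_wall N M floor_log i v" and M: "odd M"
  shows "model_sign c (block_flip floor_log {i} v) = model_sign c v + of_bool (bit c i)"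
proof -
  obtain d where d: "floor_log d = i" "\<bar>v d\<bar> = M"
    using wall by (auto simp: on_wall_def)
  have d0: "v d \<noteq> 0" using d(2) M by auto
  let ?v = "block_flip floor_log {i} v"
  have lead: "lead_sign j ?v = lead_sign j v + of_bool (j = i)" for j
    using lead_sign_block_flip_same[of d i v] lead_sign_block_flip_other[of j i v] d(1) d0 by (cases "j = i") auto
  have "(\<Sum>j | j \<le> floor_log c \<and> bit c j. lead_sign j ?v) =
     (\<Sum>j | j \<le> floor_log c \<and> bit c j. lead_sign j v) + (\<Sum>j | j \<le> floor_log c \<and> bit c j. if j = i then 1 else 0)"
    unfolding lead sum.distrib by (simp add: of_bool_def)
  also have "(\<Sum>j | j \<le> floor_log c \<and> bit c j. if j = i then 1 else 0) = (of_bool (bit c i) :: Z2.bit)"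
    using bit_imp_le_floor_log[of c i] by (subst sum.delta) auto
  finally have 1: "(\<Sum>j | j \<le> floor_log c \<and> bit c j. lead_sign j ?v) =
     (\<Sum>j | j \<le> floor_log c \<and> bit c j. lead_sign j v) + of_bool (bit c i)" .
  have 2: "(if ?v c \<noteq> 0 then of_bool (?v c < 0) + lead_sign (floor_log c) ?v else 0) =
    (if v c \<noteq> 0 then of_bool (v c < 0) + lead_sign (floor_log c) v else 0)"
    unfolding lead by (cases "lead_sign (floor_log c) v"; cases "v c < 0") (auto simp: block_flip_def)
  show ?thesis unfolding model_sign_def 1 2 by (simp only: add.assoc)
qed

lemma model_sign_eq:
  assumes c: "c \<noteq> 0" and z: "\<And>x. x < c \<Longrightarrow> v x = 0"
  shows "model_sign c v = (if v c \<noteq> 0 then of_bool (v c < 0) else lead_sign (floor_log c) v)"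
proof -
  have "lead_sign i v = 0" if "i < floor_log c" for i
  proof -
    have "x < c" if "floor_log x = i" for x
      using monoD[OF floor_log_mono, of c x] that \<open>i < floor_log c\<close> by (metis not_less)
    then show ?thesis using z unfolding lead_sign_def by auto
  qed
  then have "(\<Sum>i\<in>{i. i < floor_log c \<and> bit c i}. lead_sign i v) = 0"
    by (intro sum.neutral) auto
  moreover have "{i. i \<le> floor_log c \<and> bit c i} = insert (floor_log c) {i. i < floor_log c \<and> bit c i}"
    using bit_floor_log[OF c] by auto
  ultimately have "(\<Sum>i | i \<le> floor_log c \<and> bit c i. lead_sign i v) = lead_sign (floor_log c) v"
    by simp
  then show ?thesis unfolding model_sign_def by (simp only: add.assoc bit_add_self) simp
qed

lemma lead_sign_eq:
  assumes z: "\<And>x. x \<le> c \<Longrightarrow> v x = 0" and nz: "floor_log (Suc c) = floor_log c \<Longrightarrow> v (Suc c) \<noteq> 0"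
  shows "lead_sign (floor_log c) v = of_bool (floor_log (Suc c) = floor_log c \<and> v (Suc c) < 0)"
proof (cases "floor_log (Suc c) = floor_log c")
  case True
  have "(LEAST x. floor_log x = floor_log c \<and> v x \<noteq> 0) = Suc c"
  proof (rule Least_equality)
    fix y assume "floor_log y = floor_log c \<and> v y \<noteq> 0"
    then show "Suc c \<le> y" using z[of y] by (meson not_less_eq_eq)
  qed (use True nz in auto)
  then show ?thesis using True nz by (auto simp: lead_sign_def)
next
  case False
  have "v x = 0" if "floor_log x = floor_log c" for x
  proof (cases "x \<le> c")
    case False
    then have "Suc c \<le> x" by simp
    then have "floor_log (Suc c) \<le> floor_log x" "floor_log c \<le> floor_log (Suc c)"
      by (auto intro: monoD[OF floor_log_mono])
    with that \<open>floor_log (Suc c) \<noteq> floor_log c\<close> show ?thesis by simp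
  qed (use z in auto)
  then show ?thesis using False by (auto simp: lead_sign_def)
qed

text \<open>
  If all coordinates before \<open>c\<close> have already moved to \<open>0\<close>, then the lower blocks contribute nothing,
  and \<open>model_sign c\<close> can change only when \<open>c\<close> itself moves to \<open>0\<close>: the sign of \<open>a c\<close> then gives way to
  the sign of the next coordinate if it lies in the same block, and to \<open>+\<close> at the end of a block.
\<close>

lemma jump_model_sign:
  assumes N: "N = 2 ^ k - 1" and w: "(a, e, r) \<in> flags N M" and c: "c \<in> {1..N}"
    and IH: "\<And>x. x \<in> {1..<c} \<Longrightarrow> r x = x \<and> e x = 0"
  shows "jump (model_sign c) (vertex (a, e, r) (c-1)) (vertex (a, e, r) c) = 1 \<longleftrightarrow>
    r c = c \<and> e c = 0 \<and> (a c < 0 \<longleftrightarrow> \<not> (floor_log (Suc c) = floor_log c \<and> a (Suc c) < 0))"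
proof -
  let ?u = "vertex (a, e, r) (c-1)" and ?v = "vertex (a, e, r) c"
  have r: "r permutes {1..N}" and out: "\<And>x. x \<notin> {1..N} \<Longrightarrow> a x = 0 \<and> e x = 0"
    and ins: "\<And>x. x \<in> {1..N} \<Longrightarrow> odd (a x) \<and> \<bar>e x - a x\<bar> = 1"
    using w by (auto simp: flags_def)
  have low: "?u x = 0 \<and> ?v x = 0" if "x < c" for x
    using IH[of x] out[of x] that by (cases "x = 0") (auto simp: vertex_def)
  have high: "c \<le> r x" if "x \<in> {1..N}" "c \<le> x" for x
  proof (rule ccontr)
    assume "\<not> c \<le> r x"
    moreover have "r x \<in> {1..N}" using permutes_in_image[OF r, of x] that by blast
    ultimately have "r (r x) = r x" using IH[of "r x"] by auto
    then have "r x = x" using permutes_inj[OF r] by (meson injD)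
    then show False using that \<open>\<not> c \<le> r x\<close> by simp
  qed
  have anz: "a x \<noteq> 0" if "x \<in> {1..N}" for x using ins[OF that] by auto
  have uc: "?u c = a c" using high[OF c] c by (auto simp: vertex_def)
  have "model_sign c ?u = (if ?u c \<noteq> 0 then of_bool (?u c < 0) else lead_sign (floor_log c) ?u)"
    using c low by (intro model_sign_eq) auto
  then have su: "model_sign c ?u = of_bool (a c < 0)"
    unfolding uc using anz[OF c] by simp
  have sv: "model_sign c ?v = (if ?v c \<noteq> 0 then of_bool (?v c < 0) else lead_sign (floor_log c) ?v)"
    using c low by (intro model_sign_eq) auto
  show ?thesis
  proof (cases "r c = c \<and> e c = 0")
    case False
    have "?v c \<noteq> 0 \<and> (?v c < 0 \<longleftrightarrow> a c < 0)"
    proof (cases "r c = c")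
      case True
      then have "?v c = e c" "e c \<noteq> 0" using False by (auto simp: vertex_def)
      then show ?thesis using ins[OF c] anz[OF c] by arith
    next
      case False
      then have "?v c = a c" using high[OF c] by (auto simp: vertex_def)
      then show ?thesis using anz[OF c] by auto
    qed
    then show ?thesis using False su sv by (auto simp: jump_def)
  next
    case True
    have next_c: "?v (Suc c) = a (Suc c)" "a (Suc c) \<noteq> 0" if "floor_log (Suc c) = floor_log c"
    proof -
      have "c < 2 ^ k" using c N by auto
      moreover have "2 ^ floor_log c \<le> c" using floor_log_exp2_le [of c] c by auto
      ultimately have "(2::nat) ^ floor_log c < 2 ^ k" by (rule le_less_trans [rotated])
      then have "floor_log c < k" by simp
      then have "2 * 2 ^ floor_log (Suc c) \<le> (2::nat) ^ k"
        using that by (metis Suc_leI power_Suc power_increasing one_le_numeral)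
      then have "Suc c < 2 ^ k" using floor_log_exp2_gt[of "Suc c"] by linarith
      then have S: "Suc c \<in> {1..N}" using N by auto
      then show "a (Suc c) \<noteq> 0" by (rule anz)
      have "r (Suc c) \<noteq> c" using True permutes_inj[OF r] by (metis injD n_not_Suc_n)
      then show "?v (Suc c) = a (Suc c)" using high[of "Suc c"] S by (auto simp: vertex_def)
    qed
    have vc: "?v c = 0" using True by (simp add: vertex_def)
    have "lead_sign (floor_log c) ?v = of_bool (floor_log (Suc c) = floor_log c \<and> ?v (Suc c) < 0)"
      by (rule lead_sign_eq) (use low vc next_c in \<open>auto simp: le_less\<close>)
    then have "model_sign c ?v = of_bool (floor_log (Suc c) = floor_log c \<and> a (Suc c) < 0)"
      using sv vc next_c by auto
    then show ?thesis using True su by (auto simp: jump_def)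
  qed
qed

text \<open>
  By \<open>jump_model_sign\<close> exactly one flag is counted: the coordinates move to \<open>0\<close> in their natural order.
  Each sign is opposite to the next one in its block and negative at the end of the block.
  Blocks end at odd numbers, so \<open>a c\<close> is negative for odd \<open>c\<close>.
\<close>

lemma crossing_number_model_sign:
  assumes N: "N = 2 ^ k - 1" and M: "odd M" "0 < M"
  shows "crossing_number N M model_sign = 1"
proof -
  define a0 :: "nat \<Rightarrow> int" where "a0 c = (if c \<in> {1..N} then (if odd c then -1 else 1) else 0)" for c
  define w0 where "w0 = (a0, (\<lambda>_. 0) :: nat \<Rightarrow> int, id :: nat \<Rightarrow> nat)"
  define P where "P w = (\<Prod>c\<in>{1..N}. jump (model_sign c) (vertex w (c-1)) (vertex w c))" for w
  have w0: "w0 \<in> flags N M"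
    using M by (auto simp: w0_def a0_def flags_def permutes_id)
  have "P w0 = 1"
    unfolding P_def
  proof (rule prod.neutral, rule ballI)
    fix c assume c: "c \<in> {1..N}"
    have "a0 c < 0 \<longleftrightarrow> \<not> (floor_log (Suc c) = floor_log c \<and> a0 (Suc c) < 0)"
    proof (cases "odd c")
      case False
      then have *: "floor_log (Suc c) = floor_log c" using c by (intro floor_log_Suc_even) auto
      have "Suc c \<in> {1..N}"
      proof -
        have "c \<noteq> N" using False N c by (cases k) auto
        then show ?thesis using c by auto
      qed
      then show ?thesis using False c * by (simp add: a0_def)
    qed (use c in \<open>auto simp: a0_def\<close>)
    then show "jump (model_sign c) (vertex w0 (c - 1)) (vertex w0 c) = 1"
      using jump_model_sign[OF N w0[unfolded w0_def] c] by (auto simp: w0_def)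
  qed
  moreover have "P w = 0" if "w \<in> flags N M" "w \<noteq> w0" for w
  proof (rule ccontr)
    assume "P w \<noteq> 0"
    then have J: "jump (model_sign c) (vertex w (c - 1)) (vertex w c) = 1" if "c \<in> {1..N}" for c
      using that by (auto simp: P_def)
    obtain a e r where aer: "w = (a, e, r)" by (cases w)
    have w: "(a, e, r) \<in> flags N M" using that aer by simp
    have re: "r c = c \<and> e c = 0" if "c \<in> {1..N}" for c
      using that
    proof (induction c rule: less_induct)
      case (less c)
      then show ?case using jump_model_sign[OF N w less.prems] J[OF less.prems] by (auto simp: aer)
    qed
    have s: "a c < 0 \<longleftrightarrow> \<not> (floor_log (Suc c) = floor_log c \<and> a (Suc c) < 0)" if "c \<in> {1..N}" for c
      using jump_model_sign[OF N w that] J[OF that] re that by (auto simp: aer)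
    have out: "a c = 0 \<and> e c = 0" if "c \<notin> {1..N}" for c using w that by (auto simp: flags_def)
    have a1: "\<bar>a c\<bar> = 1" if "c \<in> {1..N}" for c
    proof -
      have "\<bar>e c - a c\<bar> = 1" using w that by (simp add: flags_def)
      then show ?thesis using re[OF that] by simp
    qed
    have neg: "a c < 0 \<longleftrightarrow> odd c" if "c \<in> {1..N}" for c
      using that
    proof (induction "N - c" arbitrary: c rule: less_induct)
      case less
      show ?case
      proof (cases "Suc c \<in> {1..N}")
        case True
        then have IH: "a (Suc c) < 0 \<longleftrightarrow> odd (Suc c)" using less by auto
        show ?thesis using s[OF less.prems] IH floor_log_Suc_even[of c] less.prems by auto
      next
        case False
        then have "c = N" using less.prems by auto
        then have "odd c" using N less.prems by (cases k) auto
        moreover have "a c < 0" using s[OF less.prems] out[OF False] by auto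
        ultimately show ?thesis by simp
      qed
    qed
    have "a c = a0 c" "e c = 0" for c
    proof -
      show "a c = a0 c"
      proof (cases "c \<in> {1..N}")
        case True
        then show ?thesis using a1 [OF True] neg [OF True] True by (cases "odd c") (simp_all add: a0_def)
      next
        case False
        then show ?thesis using out [OF False] by (simp only: a0_def if_False)
      qed
      show "e c = 0" using re [of c] out [of c] by blast
    qed
    moreover have "r c = c" for c
      using re[of c] w by (cases "c \<in> {1..N}") (auto simp: flags_def permutes_not_in)
    ultimately have "w = w0" by (auto simp: aer w0_def fun_eq_iff)
    then show False using that by simp
  qed
  then have "(\<Sum>w\<in>flags N M. P w) = (\<Sum>w\<in>{w0}. P w)"
    using w0 by (intro sum.mono_neutral_right) (auto simp: finite_flags)
  ultimately show ?thesis by (simp add: crossing_number_def P_def)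
qed

theorem exists_crossing_flag:
  fixes g :: "nat \<Rightarrow> (nat \<Rightarrow> int) \<Rightarrow> Z2.bit"
  assumes N: "N = 2 ^ k - 1" and M: "odd M" "0 < M"
    and g: "\<And>c i v. c \<in> {1..N} \<Longrightarrow> on_wall N M floor_log i v \<Longrightarrow>
              g c (block_flip floor_log {i} v) = g c v + of_bool (bit c i)"
  obtains w where "w \<in> flags N M" "\<And>c. c \<in> {1..N} \<Longrightarrow> g c (vertex w (c-1)) \<noteq> g c (vertex w c)"
proof -
  have "crossing_number N M g = crossing_number N M model_sign"
    by (rule crossing_number_replace[OF M(1), where b = floor_log and \<epsilon> = "\<lambda>c i. of_bool (bit c i)"])
       (use g model_sign_block_flip M in auto)
  also have "\<dots> = 1" using N M by (rule crossing_number_model_sign)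
  finally have "\<exists>w\<in>flags N M. (\<Prod>c\<in>{1..N}. jump (g c) (vertex w (c-1)) (vertex w c)) \<noteq> 0"
    unfolding crossing_number_def by (metis (no_types, lifting) sum.neutral zero_neq_one)
  then obtain w where w: "w \<in> flags N M"
    and "\<And>c. c \<in> {1..N} \<Longrightarrow> jump (g c) (vertex w (c-1)) (vertex w c) \<noteq> 0"
    by (auto simp: prod_zero_iff)
  then show thesis by (intro that[OF w]) (metis bit_add_self jump_def)
qed

section \<open>The covering space and a Borsuk-Ulam theorem\<close>

lemma tendsto_fun_iff:
  fixes f :: "'a \<Rightarrow> 'b \<Rightarrow> 'c::topological_space"
  shows "(f \<longlongrightarrow> l) F \<longleftrightarrow> (\<forall>i. ((\<lambda>n. f n i) \<longlongrightarrow> l i) F)"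
  using limitin_componentwise[of "\<lambda>_. euclidean" UNIV f l F]
  by (simp add: euclidean_product_topology)

lemma compact_PiE_UNIV:
  fixes S :: "'b \<Rightarrow> 'c::topological_space set"
  assumes "\<And>i. compact (S i)"
  shows "compact {f. \<forall>i. f i \<in> S i}"
proof -
  have "compactin (product_topology (\<lambda>_. euclidean) UNIV) (PiE UNIV S)"
    using assms by (simp add: compactin_PiE)
  moreover have "PiE UNIV S = {f. \<forall>i. f i \<in> S i}" by auto
  ultimately show ?thesis by (simp add: euclidean_product_topology)
qed

text \<open>
  A block of the space needs more coordinates than the corresponding block of the cube; the
  coordinate \<open>c\<close> of the cube is doubled into \<open>2 * c\<close> and \<open>2 * c + 1\<close>.
\<close>

definition blk :: "nat \<Rightarrow> nat" where
  "blk a = floor_log (a div 2)"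

lemma blk_double: "blk (2 * c) = floor_log c"
  unfolding blk_def nonzero_mult_div_cancel_left[OF zero_neq_numeral[symmetric]] ..

lemma finite_floor_log_vimage: "finite {c. floor_log c = i}"
proof (rule finite_subset)
  show "{c. floor_log c = i} \<subseteq> {..<2 * 2 ^ i}" using floor_log_exp2_gt by auto
qed simp

lemma finite_blk_vimage: "finite {a. blk a = i}"
proof (rule finite_subset)
  show "{a. blk a = i} \<subseteq> {..<4 * 2 ^ i}"
  proof
    fix a assume "a \<in> {a. blk a = i}"
    then have i: "floor_log (a div 2) = i" by (simp only: blk_def mem_Collect_eq)
    have "a div 2 < 2 * 2 ^ floor_log (a div 2)" by (rule floor_log_exp2_gt)
    then show "a \<in> {..<4 * 2 ^ i}" unfolding i lessThan_iff by linarith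
  qed
qed simp

text \<open>
  The inequality for each block keeps the block away from \<open>0\<close>, so that no point is fixed by a sign
  change.
\<close>

definition cover :: "(nat \<Rightarrow> real) set" where
  "cover = {z. (\<forall>a. \<bar>z a\<bar> \<le> 1) \<and> (\<forall>i. 1 \<le> (\<Sum>a | blk a = i. \<bar>z a\<bar>))}"

lemma continuous_on_coordinate [continuous_intros]:
  "continuous_on S (\<lambda>x :: 'b \<Rightarrow> 'c::topological_space. x i)"
  by (rule continuous_on_subset [OF continuous_on_product_coordinates subset_UNIV])

lemma compact_cover: "compact cover"
proof -
  have "compact {z::nat \<Rightarrow> real. \<forall>a. z a \<in> {-1..1}}"
    by (rule compact_PiE_UNIV) simp
  moreover have "closed (\<Inter>i. {z::nat \<Rightarrow> real. 1 \<le> (\<Sum>a | blk a = i. \<bar>z a\<bar>)})"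
    by (intro closed_INT ballI closed_Collect_le continuous_intros)
  ultimately have "compact ({z::nat \<Rightarrow> real. \<forall>a. z a \<in> {-1..1}} \<inter> (\<Inter>i. {z. 1 \<le> (\<Sum>a | blk a = i. \<bar>z a\<bar>)}))"
    by (rule compact_Int_closed)
  also have "\<dots> = cover" by (auto simp: cover_def abs_le_iff minus_le_iff)
  finally show ?thesis .
qed

text \<open>
  On each block this is the parametrisation of a hemisphere by a ball, \<open>x \<mapsto> (x, 1 - \<bar>x\<bar>)\<close>, with
  the sum norm and the second component cut off at \<open>0\<close>. This component vanishes on the walls of the cube, so that \<open>chart\<close> respects the antipodal identification
  there. It is repeated in all odd coordinates of the block.
\<close>

definition chart :: "(nat \<Rightarrow> real) \<Rightarrow> nat \<Rightarrow> real" where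
  "chart x a = (if even a then x (a div 2)
     else max 0 (1 - (\<Sum>c | floor_log c = blk a. \<bar>x c\<bar>)))"

lemma chart_in_cover:
  assumes "\<And>c. \<bar>x c\<bar> \<le> 1"
  shows "chart x \<in> cover"
proof -
  have "\<bar>chart x a\<bar> \<le> 1" for a
    using assms[of "a div 2"] sum_nonneg[of "{c. floor_log c = blk a}" "\<lambda>c. \<bar>x c\<bar>"]
    by (auto simp: chart_def)
  moreover have "1 \<le> (\<Sum>a | blk a = i. \<bar>chart x a\<bar>)" for i
  proof -
    let ?C = "{c. floor_log c = i}" and ?t = "Suc (2 * 2 ^ i)"
    have t: "blk ?t = i" by (simp add: blk_def)
    have "1 \<le> (\<Sum>c\<in>?C. \<bar>x c\<bar>) + \<bar>chart x ?t\<bar>"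
      unfolding chart_def t by auto
    also have "(\<Sum>c\<in>?C. \<bar>x c\<bar>) = (\<Sum>a\<in>(*) 2 ` ?C. \<bar>chart x a\<bar>)"
      by (subst sum.reindex) (auto simp: inj_on_def chart_def)
    also have "\<dots> + \<bar>chart x ?t\<bar> = (\<Sum>a\<in>insert ?t ((*) 2 ` ?C). \<bar>chart x a\<bar>)"
    proof -
      have "even a" if "a \<in> (*) 2 ` ?C" for a using that by auto
      then have "?t \<notin> (*) 2 ` ?C" by (metis even_Suc even_mult_iff even_numeral)
      then show ?thesis using finite_floor_log_vimage[of i] by simp
    qed
    also have "\<dots> \<le> (\<Sum>a | blk a = i. \<bar>chart x a\<bar>)"
      by (rule sum_mono2) (use t in \<open>auto simp: finite_blk_vimage blk_double\<close>)
    finally show ?thesis .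
  qed
  ultimately show ?thesis by (simp add: cover_def)
qed

lemma continuous_on_chart: "continuous_on S chart"
proof (rule continuous_on_coordinatewise_then_product)
  fix a
  show "continuous_on S (\<lambda>x. chart x a)"
    by (cases "even a") (auto simp: chart_def intro!: continuous_intros)
qed

lemma chart_block_flip:
  assumes "floor_log c = i" "\<bar>x c\<bar> = 1"
  shows "chart (block_flip floor_log {i} x) = block_flip blk {i} (chart x)"
proof
  fix a
  have "\<bar>x c\<bar> \<le> (\<Sum>c | floor_log c = i. \<bar>x c\<bar>)"
    using assms by (intro member_le_sum) (auto simp: finite_floor_log_vimage)
  moreover have "(\<Sum>c | floor_log c = j. \<bar>block_flip floor_log {i} x c\<bar>) = (\<Sum>c | floor_log c = j. \<bar>x c\<bar>)" for j
    by (intro sum.cong) (auto simp: block_flip_def)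
  ultimately show "chart (block_flip floor_log {i} x) a = block_flip blk {i} (chart x) a"
    using assms by (auto simp: chart_def block_flip_def blk_def)
qed

lemma vertex_bounds:
  assumes w: "w \<in> flags N M" and "0 \<le> M"
  shows "\<bar>vertex w l c\<bar> \<le> M" "\<bar>vertex w l c - vertex w 0 c\<bar> \<le> 1"
proof -
  obtain a e r where aer: "w = (a, e, r)" by (cases w)
  have "\<bar>a c\<bar> \<le> M \<and> \<bar>e c\<bar> \<le> M \<and> \<bar>e c - a c\<bar> \<le> 1"
    using assms by (cases "c \<in> {1..N}") (auto simp: aer flags_def)
  then show "\<bar>vertex w l c\<bar> \<le> M" "\<bar>vertex w l c - vertex w 0 c\<bar> \<le> 1"
    by (auto simp: aer vertex_def abs_minus_commute)
qed

text \<open>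
  On the grid with spacing \<open>1 / M\<close> the signs of the functions \<open>h c \<circ> chart\<close> have the equivariance that
  forces a flag crossed by all of them. A limit point of such flags for \<open>M \<rightarrow> \<infinity>\<close> is a common zero.
\<close>

theorem equivariant_functions_common_zero:
  fixes h :: "nat \<Rightarrow> (nat \<Rightarrow> real) \<Rightarrow> real"
  assumes cont: "\<And>c. c \<in> {1..<2^k} \<Longrightarrow> continuous_on cover (h c)"
    and equi: "\<And>c i z. c \<in> {1..<2^k} \<Longrightarrow> i < k \<Longrightarrow> z \<in> cover \<Longrightarrow>
       h c (block_flip blk {i} z) = (if bit c i then - h c z else h c z)"
  obtains z where "z \<in> cover" "\<And>c. c \<in> {1..<2^k} \<Longrightarrow> h c z = 0"
proof -
  define N :: nat where "N = 2 ^ k - 1"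
  have N: "{1..<2^k} = {1..N}" by (auto simp: N_def)
  define M where "M n = int (2 * n + 1)" for n
  have M: "odd (M n)" "0 < M n" for n by (auto simp: M_def)
  define pt where "pt n v = (\<lambda>c. real_of_int (v c) / real_of_int (M n))" for n and v :: "nat \<Rightarrow> int"
  define cube :: "nat \<Rightarrow> (nat \<Rightarrow> int) set" where "cube n = {v. \<forall>c. \<bar>v c\<bar> \<le> M n}" for n
  have pt_le: "\<bar>pt n v c\<bar> \<le> 1" if "v \<in> cube n" for n v c
  proof -
    have "\<bar>real_of_int (v c)\<bar> \<le> real_of_int (M n)" using that by (auto simp: cube_def) (metis of_int_abs of_int_le_iff)
    then show ?thesis using M(2)[of n] by (simp add: pt_def divide_le_eq)
  qed
  \<comment> \<open>the model sign breaks ties at zeros of \<open>h c\<close> in an equivariant way, and serves outside the cube\<close>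
  define g where "g n c v = (if v \<in> cube n \<and> h c (chart (pt n v)) > 0 then 0
      else if v \<in> cube n \<and> h c (chart (pt n v)) < 0 then 1 else model_sign c v)" for n c v
  have "\<exists>w\<in>flags N (M n). \<forall>c\<in>{1..N}. g n c (vertex w (c-1)) \<noteq> g n c (vertex w c)" for n
  proof -
    have "g n c (block_flip floor_log {i} v) = g n c v + of_bool (bit c i)"
      if c: "c \<in> {1..N}" and wall: "on_wall N (M n) floor_log i v" for c i v
    proof -
      obtain d where d: "d \<in> {1..N}" "floor_log d = i" "\<bar>v d\<bar> = M n"
        using wall by (auto simp: on_wall_def)
      have ik: "i < k"
      proof -
        have "2 ^ i \<le> d" using d floor_log_exp2_le[of d] by auto
        also have "d < 2 ^ k" using d(1) unfolding N [symmetric] by simp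
        finally show ?thesis by simp
      qed
      have "real_of_int \<bar>v d\<bar> = real_of_int (M n)" using d by simp
      then have "\<bar>pt n v d\<bar> = 1" using M(2)[of n] by (simp add: pt_def)
      have chart: "chart (pt n (block_flip floor_log {i} v)) = block_flip blk {i} (chart (pt n v))"
      proof -
        have "pt n (block_flip floor_log {i} v) = block_flip floor_log {i} (pt n v)"
          by (auto simp: pt_def block_flip_def)
        then show ?thesis using chart_block_flip[OF d(2), of "pt n v"] \<open>\<bar>pt n v d\<bar> = 1\<close> by simp
      qed
      have cube: "block_flip floor_log {i} v \<in> cube n \<longleftrightarrow> v \<in> cube n"
        by (simp add: cube_def block_flip_def if_distrib cong: if_cong)
      have H: "h c (chart (pt n (block_flip floor_log {i} v))) =
          (if bit c i then - h c (chart (pt n v)) else h c (chart (pt n v)))" if "v \<in> cube n"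
        unfolding chart using c [folded N] ik that by (intro equi chart_in_cover pt_le) auto
      show ?thesis
        unfolding g_def cube model_sign_block_flip[OF wall M(1)] using H by auto
    qed
    from exists_crossing_flag[OF N_def M this] show ?thesis by metis
  qed
  then obtain w where w: "\<And>n. w n \<in> flags N (M n)"
    and cross: "\<And>n c. c \<in> {1..N} \<Longrightarrow> g n c (vertex (w n) (c-1)) \<noteq> g n c (vertex (w n) c)"
    by metis
  have vcube: "vertex (w n) l \<in> cube n" for n l
    using vertex_bounds[OF w, of n l] M(2)[of n] by (auto simp: cube_def)
  have "compact {x::nat \<Rightarrow> real. \<forall>c. x c \<in> {-1..1}}"
    by (rule compact_PiE_UNIV) simp
  moreover have "pt n (vertex (w n) 0) \<in> {x. \<forall>c. x c \<in> {-1..1}}" for n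
    using pt_le[OF vcube[of n 0]] by (auto simp: abs_le_iff minus_le_iff)
  ultimately obtain x s where x: "x \<in> {x::nat \<Rightarrow> real. \<forall>c. x c \<in> {-1..1}}" and s: "strict_mono s"
    and lim0: "((\<lambda>n. pt n (vertex (w n) 0)) \<circ> s) \<longlonglongrightarrow> x"
    unfolding compact_def by meson
  have lim: "(\<lambda>n. pt (s n) (vertex (w (s n)) l)) \<longlonglongrightarrow> x" for l
    unfolding tendsto_fun_iff
  proof
    fix c
    have "\<bar>pt (s n) (vertex (w (s n)) l) c - pt (s n) (vertex (w (s n)) 0) c\<bar> \<le> inverse (real (Suc n))" for n
    proof -
      have "\<bar>real_of_int (vertex (w (s n)) l c) - real_of_int (vertex (w (s n)) 0 c)\<bar> \<le> 1"
        using vertex_bounds(2)[OF w, of "s n" l c] M(2)[of "s n"] by linarith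
      then have "\<bar>pt (s n) (vertex (w (s n)) l) c - pt (s n) (vertex (w (s n)) 0) c\<bar> \<le> 1 / real (2 * s n + 1)"
        by (simp add: pt_def M_def divide_right_mono flip: diff_divide_distrib)
      also have "\<dots> \<le> inverse (real (Suc n))"
        using seq_suble[OF s, of n] by (simp add: field_simps)
      finally show ?thesis .
    qed
    then have "(\<lambda>n. pt (s n) (vertex (w (s n)) l) c - pt (s n) (vertex (w (s n)) 0) c) \<longlonglongrightarrow> 0"
      by (intro Lim_null_comparison[OF always_eventually LIMSEQ_inverse_real_of_nat]) auto
    moreover have "(\<lambda>n. pt (s n) (vertex (w (s n)) 0) c) \<longlonglongrightarrow> x c"
      using lim0 unfolding tendsto_fun_iff o_def by blast
    ultimately show "(\<lambda>n. pt (s n) (vertex (w (s n)) l) c) \<longlonglongrightarrow> x c"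
      using tendsto_add by fastforce
  qed
  have lx: "chart x \<in> cover" using x by (intro chart_in_cover) (auto simp: abs_le_iff minus_le_iff)
  have "h c (chart x) = 0" if c: "c \<in> {1..<2^k}" for c
  proof -
    have hlim: "(\<lambda>n. h c (chart (pt (s n) (vertex (w (s n)) l)))) \<longlonglongrightarrow> h c (chart x)" for l
    proof (rule continuous_on_tendsto_compose[OF cont[OF c]])
      show "(\<lambda>n. chart (pt (s n) (vertex (w (s n)) l))) \<longlonglongrightarrow> chart x"
        by (rule continuous_on_tendsto_compose[OF continuous_on_chart[of UNIV] lim]) auto
    qed (use lx chart_in_cover[OF pt_le[OF vcube]] in auto)
    have "h c (chart (pt n (vertex (w n) (c-1)))) * h c (chart (pt n (vertex (w n) c))) \<le> 0" for n
      using cross[of c n] c vcube[of n] unfolding N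
      by (auto simp: g_def mult_le_0_iff not_less split: if_splits)
    then have "h c (chart x) * h c (chart x) \<le> 0"
      by (intro LIMSEQ_le_const2[OF tendsto_mult[OF hlim[of "c-1"] hlim[of c]]]) auto
    then show ?thesis by (auto simp: mult_le_0_iff)
  qed
  with lx show thesis by (rule that)
qed

section \<open>Idempotent measures over a point\<close>

lemma I_set_const: "\<mu> \<in> I_set X \<Longrightarrow> \<mu> (C_const X c) = c"
  and I_set_odot: "\<mu> \<in> I_set X \<Longrightarrow> \<phi> \<in> C_fun X \<Longrightarrow> \<mu> (C_odot X c \<phi>) = c + \<mu> \<phi>"
  and I_set_oplus: "\<mu> \<in> I_set X \<Longrightarrow> \<phi> \<in> C_fun X \<Longrightarrow> \<psi> \<in> C_fun X \<Longrightarrow>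
    \<mu> (C_oplus X \<phi> \<psi>) = max (\<mu> \<phi>) (\<mu> \<psi>)"
  by (simp_all add: I_set_def idempotent_prob_measure_def)

lemma I_set_mono:
  assumes \<mu>: "\<mu> \<in> I_set X" and C: "\<phi> \<in> C_fun X" "\<psi> \<in> C_fun X"
    and le: "\<And>x. x \<in> topspace X \<Longrightarrow> \<phi> x \<le> \<psi> x + c"
  shows "\<mu> \<phi> \<le> \<mu> \<psi> + c"
proof -
  have "C_oplus X \<phi> (C_odot X c \<psi>) = C_odot X c \<psi>"
    using le by (auto simp: C_oplus_def C_odot_def C_const_def fun_eq_iff add.commute max_def)
  moreover have "\<mu> (C_oplus X \<phi> (C_odot X c \<psi>)) = max (\<mu> \<phi>) (c + \<mu> \<psi>)"
    by (simp add: I_set_oplus [OF \<mu>] I_set_odot [OF \<mu>] C C_odot_in_C_fun)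
  moreover have "\<mu> (C_odot X c \<psi>) = c + \<mu> \<psi>"
    by (simp add: I_set_odot [OF \<mu>] C)
  ultimately show ?thesis by (simp add: add.commute max_def split: if_splits)
qed

lemma I_set_Max:
  assumes \<mu>: "\<mu> \<in> I_set X" and "finite A" "A \<noteq> {}" and "\<And>i. i \<in> A \<Longrightarrow> F i \<in> C_fun X"
  shows "(\<lambda>x\<in>topspace X. MAX i\<in>A. F i x) \<in> C_fun X \<and>
    \<mu> (\<lambda>x\<in>topspace X. MAX i\<in>A. F i x) = (MAX i\<in>A. \<mu> (F i))"
  using assms(2-)
proof (induction A rule: finite_ne_induct)
  case (singleton i)
  then have "(\<lambda>x\<in>topspace X. F i x) = F i"
    by (intro extensional_restrict) (auto simp: C_fun_def)
  then show ?case using singleton by simp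
next
  case (insert i A)
  have "(\<lambda>x\<in>topspace X. MAX j\<in>insert i A. F j x) = C_oplus X (F i) (\<lambda>x\<in>topspace X. MAX j\<in>A. F j x)"
    using insert.hyps by (auto simp: C_oplus_def fun_eq_iff)
  moreover have "(MAX j\<in>insert i A. \<mu> (F j)) = max (\<mu> (F i)) (MAX j\<in>A. \<mu> (F j))"
    using insert.hyps by simp
  moreover have "(\<lambda>x\<in>topspace X. MAX j\<in>A. F j x) \<in> C_fun X \<and>
      \<mu> (\<lambda>x\<in>topspace X. MAX j\<in>A. F j x) = (MAX j\<in>A. \<mu> (F j))"
    by (rule insert.IH) (use insert.prems in blast)
  moreover have "F i \<in> C_fun X" using insert.prems by blast
  ultimately show ?case
    by (simp only: C_oplus_in_C_fun I_set_oplus [OF \<mu>] simp_thms)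
qed

lemma C_fun_top_of_set: "\<phi> \<in> C_fun (top_of_set S) \<longleftrightarrow> continuous_on S \<phi> \<and> \<phi> \<in> extensional S"
  by (simp add: C_fun_def)

lemma restrict_in_C_fun: "continuous_on S \<phi> \<Longrightarrow> restrict \<phi> S \<in> C_fun (top_of_set S)"
  by (simp add: C_fun_top_of_set cong: continuous_on_cong)

text \<open>
  A measure whose image is the Dirac measure at \<open>y\<close> is supported on the fiber of \<open>y\<close>. Off a neighbourhood
  of the fiber, \<open>\<phi>\<close> is dominated by the pullback of some \<open>\<beta>\<close> on the base with \<open>\<beta> y\<close> as small as desired,
  for instance a steep cone with apex at \<open>y\<close>; the measure of the pullback is just \<open>\<beta> y\<close>.
\<close>

lemma I_set_le_if_le_on_fiber:
  fixes f :: "'a::metric_space \<Rightarrow> 'b::metric_space"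
  assumes S: "compact S" and f: "continuous_on S f" "f ` S \<subseteq> T"
    and \<mu>: "\<mu> \<in> I_set (top_of_set S)"
    and dirac: "\<And>\<beta>. \<beta> \<in> C_fun (top_of_set T) \<Longrightarrow> I_map (top_of_set S) (top_of_set T) f \<mu> \<beta> = \<beta> y"
    and y: "y \<in> T"
    and C: "\<phi> \<in> C_fun (top_of_set S)" "\<psi> \<in> C_fun (top_of_set S)"
    and le: "\<And>x. x \<in> S \<Longrightarrow> f x = y \<Longrightarrow> \<phi> x \<le> \<psi> x + c"
  shows "\<mu> \<phi> \<le> \<mu> \<psi> + c"
proof (rule field_le_epsilon)
  fix \<epsilon> :: real assume \<epsilon>: "0 < \<epsilon>"
  have cont: "continuous_on S \<phi>" "continuous_on S \<psi>" using C by (auto simp: C_fun_top_of_set)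
  define B where "B = {x \<in> S. \<psi> x + c + \<epsilon> \<le> \<phi> x}"
  have "closedin (top_of_set S) B"
  proof -
    have "B = S \<inter> (\<lambda>x. \<phi> x - \<psi> x) -` {c + \<epsilon>..}" by (auto simp: B_def)
    then show ?thesis using cont by (auto intro!: continuous_closedin_preimage continuous_intros)
  qed
  then have B: "compact B" using S closedin_compact by blast
  show "\<mu> \<phi> \<le> \<mu> \<psi> + c + \<epsilon>"
  proof (cases "B = {}")
    case True
    then have "\<mu> \<phi> \<le> \<mu> \<psi> + (c + \<epsilon>)"
      by (intro I_set_mono[OF \<mu> C]) (force simp: B_def)
    then show ?thesis by simp
  next
    case False
    have BS: "B \<subseteq> S" by (auto simp: B_def)
    have "continuous_on B (\<lambda>x. dist (f x) y)"
      using f(1) BS by (intro continuous_intros) (rule continuous_on_subset)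
    from continuous_attains_inf[OF B False this] obtain x0
      where x0: "x0 \<in> B" "\<And>x. x \<in> B \<Longrightarrow> dist (f x0) y \<le> dist (f x) y" by blast
    from continuous_attains_sup[OF B False continuous_on_subset[OF cont(1) BS]] obtain x1
      where x1: "\<And>x. x \<in> B \<Longrightarrow> \<phi> x \<le> \<phi> x1" by blast
    define \<rho> where "\<rho> = dist (f x0) y"
    have "f x0 \<noteq> y" using x0(1) le[of x0] \<epsilon> by (auto simp: B_def)
    then have \<rho>: "0 < \<rho>" by (simp add: \<rho>_def)
    define L where "L = \<mu> \<psi> + c"
    define R where "R = \<bar>\<phi> x1 - L\<bar> / \<rho>"
    define \<beta> where "\<beta> = (\<lambda>t\<in>T. L + R * dist t y)"
    have \<beta>: "\<beta> \<in> C_fun (top_of_set T)"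
      unfolding \<beta>_def by (intro restrict_in_C_fun continuous_intros)
    let ?\<beta> = "restrict (\<beta> \<circ> f) S"
    have \<beta>f: "?\<beta> \<in> C_fun (top_of_set S)"
      using pullback_in_C_fun[of "top_of_set S" "top_of_set T" f \<beta>] f \<beta> by (auto simp: image_subset_iff)
    have "\<mu> ?\<beta> = L"
      using dirac[OF \<beta>] \<beta> y by (simp add: I_map_def \<beta>_def)
    moreover have "\<mu> \<phi> \<le> \<mu> (C_oplus (top_of_set S) (C_odot (top_of_set S) (c + \<epsilon>) \<psi>) ?\<beta>) + 0"
    proof (rule I_set_mono[OF \<mu> C(1)])
      show "C_oplus (top_of_set S) (C_odot (top_of_set S) (c + \<epsilon>) \<psi>) ?\<beta> \<in> C_fun (top_of_set S)"
        by (intro C_oplus_in_C_fun C_odot_in_C_fun C \<beta>f)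
      fix x assume "x \<in> topspace (top_of_set S)"
      then have x: "x \<in> S" by simp
      show "\<phi> x \<le> C_oplus (top_of_set S) (C_odot (top_of_set S) (c + \<epsilon>) \<psi>) ?\<beta> x + 0"
      proof (cases "x \<in> B")
        case True
        have "\<phi> x1 - L \<le> R * \<rho>" using \<rho> by (simp add: R_def)
        also have "\<dots> \<le> R * dist (f x) y"
          using x0(2)[OF True] \<rho> by (intro mult_left_mono) (auto simp: R_def \<rho>_def)
        finally have "\<phi> x \<le> \<beta> (f x)"
          using x1[OF True] f(2) x by (auto simp: \<beta>_def)
        then show ?thesis using x by (simp add: C_oplus_def)
      next
        case False
        then show ?thesis using x by (auto simp: B_def C_oplus_def C_odot_def C_const_def)
      qed
    qed
    moreover have "\<mu> (C_oplus (top_of_set S) (C_odot (top_of_set S) (c + \<epsilon>) \<psi>) ?\<beta>) =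
        max (c + \<epsilon> + \<mu> \<psi>) (\<mu> ?\<beta>)"
      by (simp add: I_set_oplus [OF \<mu>] I_set_odot [OF \<mu>] C C_odot_in_C_fun \<beta>f)
    ultimately show ?thesis using \<epsilon> by (simp add: L_def max_def split: if_splits)
  qed
qed

definition dirac :: "'a topology \<Rightarrow> 'a \<Rightarrow> ('a \<Rightarrow> real) \<Rightarrow> real" where
  "dirac Y y = (\<lambda>\<phi>\<in>C_fun Y. \<phi> y)"

lemma dirac_in_I_set: "y \<in> topspace Y \<Longrightarrow> dirac Y y \<in> I_set Y"
  using C_const_in_C_fun[of Y] C_odot_in_C_fun[of _ Y] C_oplus_in_C_fun[of _ Y]
  by (auto simp: dirac_def I_set_def idempotent_prob_measure_def C_const_def C_odot_def C_oplus_def)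

lemma continuous_map_I_top_eval:
  assumes "\<phi> \<in> C_fun X"
  shows "continuous_map (I_top X) euclideanreal (\<lambda>\<mu>. \<mu> \<phi>)"
  unfolding continuous_map_def
proof (intro conjI allI impI)
  fix U :: "real set" assume "openin euclideanreal U"
  then have U: "open U" by simp
  show "openin (I_top X) {\<mu> \<in> topspace (I_top X). \<mu> \<phi> \<in> U}"
    unfolding openin_I_top
  proof (intro conjI ballI)
    fix \<mu> assume "\<mu> \<in> {\<mu> \<in> topspace (I_top X). \<mu> \<phi> \<in> U}"
    then obtain e where e: "e > 0" "ball (\<mu> \<phi>) e \<subseteq> U" using U open_contains_ball by blast
    then have "I_nbhd X \<mu> {\<phi>} e \<subseteq> {\<mu> \<in> topspace (I_top X). \<mu> \<phi> \<in> U}"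
      by (auto simp: I_nbhd_def subset_iff dist_real_def)
    then show "\<exists>F \<epsilon>. finite F \<and> F \<subseteq> C_fun X \<and> \<epsilon> > 0 \<and> I_nbhd X \<mu> F \<epsilon> \<subseteq> {\<mu> \<in> topspace (I_top X). \<mu> \<phi> \<in> U}"
      using e assms by (intro exI[of _ "{\<phi>}"] exI[of _ e]) auto
  qed auto
qed auto

lemma continuous_map_dirac: "continuous_map Y (I_top Y) (dirac Y)"
  unfolding continuous_map_def
proof (intro conjI allI impI)
  show "dirac Y \<in> topspace Y \<rightarrow> topspace (I_top Y)" by (auto intro: dirac_in_I_set)
  fix U assume U: "openin (I_top Y) U"
  show "openin Y {y \<in> topspace Y. dirac Y y \<in> U}"
  proof (subst openin_subopen, intro ballI)
    fix y assume y: "y \<in> {y \<in> topspace Y. dirac Y y \<in> U}"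
    then obtain F \<epsilon> where F: "finite F" "F \<subseteq> C_fun Y" "\<epsilon> > 0" "I_nbhd Y (dirac Y y) F \<epsilon> \<subseteq> U"
      using U unfolding openin_I_top by blast
    define V where "V = topspace Y \<inter> (\<Inter>\<phi>\<in>F. {x \<in> topspace Y. \<phi> x \<in> ball (\<phi> y) \<epsilon>})"
    have "openin Y {x \<in> topspace Y. \<phi> x \<in> ball (\<phi> y) \<epsilon>}" if "\<phi> \<in> F" for \<phi>
      using that F by (intro openin_continuous_map_preimage[of Y euclideanreal]) (auto simp: C_fun_def)
    then have "openin Y V"
      using F(1) unfolding V_def by (cases "F = {}") (auto intro!: openin_Int openin_INT)
    moreover have "y \<in> V" using y F by (auto simp: V_def)
    moreover have "V \<subseteq> {y \<in> topspace Y. dirac Y y \<in> U}"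
    proof
      fix x assume x: "x \<in> V"
      then have "dirac Y x \<in> I_nbhd Y (dirac Y y) F \<epsilon>"
        using F(2) dirac_in_I_set[of x Y] by (auto simp: V_def I_nbhd_def dist_real_def) (auto simp: dirac_def)
      then show "x \<in> {y \<in> topspace Y. dirac Y y \<in> U}" using F(4) x by (auto simp: V_def)
    qed
    ultimately show "\<exists>T. openin Y T \<and> y \<in> T \<and> T \<subseteq> {y \<in> topspace Y. dirac Y y \<in> U}" by blast
  qed
qed

text \<open>
  Two points of the Hilbert cube give two nowhere equal sections.
\<close>

lemma trivial_Q_bundle_disjoint_lifts:
  assumes triv: "trivial_Q_bundle E B g" and d: "continuous_map Y B d"
  obtains s0 s1 where "continuous_map Y E s0" "continuous_map Y E s1"
    "\<And>y. y \<in> topspace Y \<Longrightarrow> g (s0 y) = d y" "\<And>y. y \<in> topspace Y \<Longrightarrow> g (s1 y) = d y"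
    "\<And>y. y \<in> topspace Y \<Longrightarrow> s0 y \<noteq> s1 y"
proof -
  obtain h where h: "homeomorphic_map E (prod_topology B Hilbert_cube) h"
    and fst: "\<And>e. e \<in> topspace E \<Longrightarrow> fst (h e) = g e"
    using triv by (auto simp: trivial_Q_bundle_def)
  from h obtain h' where hh': "homeomorphic_maps E (prod_topology B Hilbert_cube) h h'"
    by (auto simp: homeomorphic_map_maps)
  then have h': "continuous_map (prod_topology B Hilbert_cube) E h'"
    and inv: "\<And>x. x \<in> topspace (prod_topology B Hilbert_cube) \<Longrightarrow> h (h' x) = x"
    by (auto simp: homeomorphic_maps_def)
  define s where "s c y = h' (d y, (\<lambda>_::nat. c))" for c :: real and y
  have Q: "(\<lambda>_::nat. c) \<in> topspace Hilbert_cube" if "c \<in> {0..1}" for c :: real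
    using that by (simp add: Hilbert_cube_def PiE_iff)
  have pt: "(d y, (\<lambda>_::nat. c)) \<in> topspace (prod_topology B Hilbert_cube)"
    if "c \<in> {0..1}" "y \<in> topspace Y" for c :: real and y
    using Q[OF that(1)] continuous_map_image_subset_topspace[OF d] that(2) by auto
  have cont: "continuous_map Y E (s c)" if "c \<in> {0..1}" for c
  proof -
    have "continuous_map Y (prod_topology B Hilbert_cube) (\<lambda>y. (d y, (\<lambda>_::nat. c)))"
      using d Q[OF that] by (simp add: continuous_map_pairedI)
    then show ?thesis
      using continuous_map_compose[OF _ h'] unfolding s_def o_def by blast
  qed
  have hs: "h (s c y) = (d y, (\<lambda>_. c))" if "c \<in> {0..1}" "y \<in> topspace Y" for c y
    unfolding s_def using inv[OF pt[OF that]] .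
  have lift: "g (s c y) = d y" if "c \<in> {0..1}" "y \<in> topspace Y" for c y
  proof -
    have "s c y \<in> topspace E" using continuous_map_image_subset_topspace[OF cont[OF that(1)]] that(2) by auto
    then show ?thesis using fst hs[OF that] by (metis fst_conv)
  qed
  have "s 0 y \<noteq> s 1 y" if "y \<in> topspace Y" for y
    using hs[of 0 y] hs[of 1 y] that by (auto simp: fun_eq_iff)
  then show thesis using that[of "s 0" "s 1"] cont lift by simp
qed

section \<open>The orbit map\<close>

text \<open>
  The quadratic functions \<open>z a * z b\<close> with \<open>a\<close> and \<open>b\<close> in one block separate the orbits of the sign
  changes of blocks, so this is the orbit map onto a concrete model of the orbit space.
\<close>

definition products :: "(nat \<Rightarrow> real) \<Rightarrow> nat \<Rightarrow> real" where
  "products z n = (case prod_decode n of (a, b) \<Rightarrow> if blk a = blk b then z a * z b else 0)"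

lemma products_encode: "products z (prod_encode (a, b)) = (if blk a = blk b then z a * z b else 0)"
  by (simp add: products_def)

lemma continuous_on_products: "continuous_on S products"
proof (rule continuous_on_coordinatewise_then_product)
  fix n
  show "continuous_on S (\<lambda>z. products z n)"
    by (cases "blk (fst (prod_decode n)) = blk (snd (prod_decode n))")
      (auto simp: products_def case_prod_beta intro!: continuous_intros)
qed

lemma products_block_flip [simp]: "products (block_flip blk p z) = products z"
  by (auto simp: products_def block_flip_def fun_eq_iff split: prod.split)

lemma products_eqD:
  assumes "products w = products z"
  obtains p where "w = block_flip blk p z"
proof -
  have eq: "w a * w b = z a * z b" if "blk a = blk b" for a b
    using fun_cong[OF assms, of "prod_encode (a, b)"] that by (simp add: products_encode)
  define p where "p = {i. \<exists>b. blk b = i \<and> w b \<noteq> z b}"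
  have "w a = (if blk a \<in> p then - z a else z a)" for a
  proof (cases "blk a \<in> p")
    case True
    then obtain b where b: "blk b = blk a" "w b \<noteq> z b" by (auto simp: p_def)
    have "w b = - z b" "z b \<noteq> 0" using eq[of b b] b(2) by (auto simp: square_eq_iff)
    then have "(w a + z a) * z b = 0" using eq[of a b] b(1) by (simp add: distrib_right)
    then show ?thesis using True \<open>z b \<noteq> 0\<close> by (simp add: add_eq_0_iff2)
  next
    case False
    then show ?thesis by (auto simp: p_def)
  qed
  then show thesis by (intro that[of p]) (auto simp: block_flip_def)
qed

lemma block_flip_in_cover: "z \<in> cover \<Longrightarrow> block_flip blk p z \<in> cover"
proof -
  assume z: "z \<in> cover"
  have "\<bar>block_flip blk p z a\<bar> = \<bar>z a\<bar>" for a by (simp add: block_flip_def)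
  then show ?thesis using z by (simp add: cover_def)
qed

lemma block_flip_sym_diff: "block_flip b p (block_flip b q z) = block_flip b (sym_diff p q) z"
  by (auto simp: block_flip_def fun_eq_iff)

lemma continuous_on_block_flip: "continuous_on S (block_flip b p :: (nat \<Rightarrow> real) \<Rightarrow> _)"
proof (rule continuous_on_coordinatewise_then_product)
  fix a
  show "continuous_on S (\<lambda>z :: nat \<Rightarrow> real. block_flip b p z a)"
    by (cases "b a \<in> p") (auto simp: block_flip_def intro!: continuous_intros)
qed

lemma infinite_fiber:
  assumes z: "z \<in> cover"
  shows "infinite {w \<in> cover. products w = products z}"
proof -
  have nz: "\<exists>a. blk a = i \<and> z a \<noteq> 0" for i
  proof (rule ccontr)
    assume "\<not> ?thesis"
    then have "(\<Sum>a | blk a = i. \<bar>z a\<bar>) = 0" by (intro sum.neutral) auto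
    moreover have "1 \<le> (\<Sum>a | blk a = i. \<bar>z a\<bar>)" using z by (auto simp: cover_def)
    ultimately show False by simp
  qed
  have "inj (\<lambda>i. block_flip blk {i} z)"
  proof (rule injI)
    fix i j assume eq: "block_flip blk {i} z = block_flip blk {j} z"
    obtain a where a: "blk a = i" "z a \<noteq> 0" using nz by blast
    then show "i = j" using fun_cong[OF eq, of a] by (auto simp: block_flip_def split: if_splits)
  qed
  then have "infinite (range (\<lambda>i. block_flip blk {i} z))" by (rule range_inj_infinite)
  moreover have "range (\<lambda>i. block_flip blk {i} z) \<subseteq> {w \<in> cover. products w = products z}"
    using block_flip_in_cover[OF z] by auto
  ultimately show ?thesis by (rule infinite_super[rotated])
qed

lemma open_map_products: "open_map (top_of_set cover) (top_of_set (products ` cover)) products"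
  unfolding open_map_def
proof (intro allI impI)
  fix U assume U: "openin (top_of_set cover) U"
  then have UC: "U \<subseteq> cover" by (auto simp: openin_subtopology)
  define W where "W = (\<Union>p. cover \<inter> block_flip blk p -` U)"
  have "openin (top_of_set cover) W"
    unfolding W_def
  proof (rule openin_Union, clarsimp)
    fix p :: "nat set"
    show "openin (top_of_set cover) (cover \<inter> block_flip blk p -` U)"
      by (rule continuous_openin_preimage[OF continuous_on_block_flip _ U]) (auto intro: block_flip_in_cover)
  qed
  then have "closedin (top_of_set cover) (cover - W)" by (simp add: closedin_diff)
  then have "compact (cover - W)" using compact_cover closedin_compact by blast
  then have "compact (products ` (cover - W))" by (rule compact_continuous_image[OF continuous_on_products])
  then have "closedin (top_of_set (products ` cover)) (products ` (cover - W))"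
    by (intro closed_subset compact_imp_closed) auto
  moreover have "products ` U = products ` cover - products ` (cover - W)"
  proof
    show "products ` U \<subseteq> products ` cover - products ` (cover - W)"
    proof clarify
      fix u assume u: "u \<in> U"
      have "products u \<noteq> products w" if "w \<in> cover - W" for w
      proof
        assume "products u = products w"
        then obtain p where "u = block_flip blk p w" by (rule products_eqD)
        then show False using u that by (auto simp: W_def)
      qed
      then show "products u \<in> products ` cover - products ` (cover - W)" using u UC by auto
    qed
    show "products ` cover - products ` (cover - W) \<subseteq> products ` U"
    proof clarify
      fix w assume w: "w \<in> cover" "products w \<notin> products ` (cover - W)"
      then have "w \<in> W" by auto
      then obtain p where "block_flip blk p w \<in> U" by (auto simp: W_def)
      then show "products w \<in> products ` U" by (metis imageI products_block_flip)
    qed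
  qed
  ultimately show "openin (top_of_set (products ` cover)) (products ` U)"
    by (metis openin_diff openin_topspace topspace_euclidean_subtopology)
qed

section \<open>Measures on sign patterns\<close>

text \<open>
  The factor \<open>k\<close> makes the Lipschitz constant and the number of visible blocks grow together.
\<close>

definition block_dist :: "nat \<Rightarrow> (nat \<Rightarrow> real) \<Rightarrow> (nat \<Rightarrow> real) \<Rightarrow> real" where
  "block_dist k z w = real k * (\<Sum>a | blk a < k. \<bar>w a - z a\<bar>)"

lemma finite_blk_less: "finite {a. blk a < k}"
proof -
  have "{a. blk a < k} = (\<Union>i<k. {a. blk a = i})" by auto
  then show ?thesis using finite_blk_vimage by simp
qed

lemma block_dist_nonneg: "0 \<le> block_dist k z w"
  by (auto simp: block_dist_def intro!: mult_nonneg_nonneg sum_nonneg)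

lemma block_dist_triangle: "block_dist k z w \<le> block_dist k z' w + block_dist k z z'"
proof -
  have "(\<Sum>a | blk a < k. \<bar>w a - z a\<bar>) \<le> (\<Sum>a | blk a < k. \<bar>w a - z' a\<bar> + \<bar>z' a - z a\<bar>)"
    by (intro sum_mono) auto
  then show ?thesis
    by (simp add: block_dist_def sum.distrib mult_left_mono flip: distrib_left)
qed

lemma block_dist_commute: "block_dist k z w = block_dist k w z"
  by (simp add: block_dist_def abs_minus_commute)

lemma continuous_on_block_dist: "continuous_on S (\<lambda>w. block_dist k z w)"
  unfolding block_dist_def by (intro continuous_intros)

text \<open>
  A continuous function on the cover is, up to \<open>\<epsilon>\<close>, a Lipschitz function of the coordinates of
  finitely many blocks. Otherwise there are pairs of points with \<open>\<phi>\<close>-values \<open>\<epsilon>\<close> apart whose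
  coordinates in any given block become arbitrarily close, and a limit of such pairs contradicts continuity.
\<close>

lemma eventually_block_Lipschitz:
  assumes \<phi>: "continuous_on cover \<phi>" and \<epsilon>: "(0::real) < \<epsilon>"
  obtains K where "\<And>k w w'. K \<le> k \<Longrightarrow> w \<in> cover \<Longrightarrow> w' \<in> cover \<Longrightarrow> \<phi> w' \<le> \<phi> w + \<epsilon> + block_dist k w w'"
proof (rule ccontr)
  assume "\<not> thesis"
  then have "\<forall>n. \<exists>k w w'. Suc n \<le> k \<and> w \<in> cover \<and> w' \<in> cover \<and> \<phi> w + \<epsilon> + block_dist k w w' < \<phi> w'"
    using that by (metis not_less)
  then obtain k w w' where k: "\<And>n. Suc n \<le> k n" and w: "\<And>n. w n \<in> cover" "\<And>n. w' n \<in> cover"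
    and less: "\<And>n. \<phi> (w n) + \<epsilon> + block_dist (k n) (w n) (w' n) < \<phi> (w' n)"
    by metis
  have "bounded (\<phi> ` cover)"
    using compact_continuous_image[OF \<phi> compact_cover] by (rule compact_imp_bounded)
  then obtain B where B: "\<And>z. z \<in> cover \<Longrightarrow> \<bar>\<phi> z\<bar> \<le> B"
    unfolding bounded_iff by auto
  have close: "\<bar>w' n a - w n a\<bar> \<le> 2 * B * inverse (real (Suc n))" if "blk a \<le> n" for n a
  proof -
    have "\<bar>w' n a - w n a\<bar> \<le> (\<Sum>a | blk a < k n. \<bar>w' n a - w n a\<bar>)"
      using that k[of n] finite_blk_less by (intro member_le_sum) auto
    then have "real (Suc n) * \<bar>w' n a - w n a\<bar> \<le> block_dist (k n) (w n) (w' n)"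
      unfolding block_dist_def using k[of n] by (intro mult_mono) auto
    also have "\<dots> \<le> 2 * B"
      using less[of n] B[OF w(1), of n] B[OF w(2), of n] \<epsilon> by linarith
    finally show ?thesis by (simp add: field_simps)
  qed
  have "compact (cover \<times> cover)" by (intro compact_Times compact_cover)
  moreover have "\<And>n. (w n, w' n) \<in> cover \<times> cover" using w by auto
  ultimately obtain l s where l: "l \<in> cover \<times> cover" and s: "strict_mono s"
    and lim: "((\<lambda>n. (w n, w' n)) \<circ> s) \<longlonglongrightarrow> l"
    using seq_compactE[OF compact_imp_seq_compact, of "cover \<times> cover" "\<lambda>n. (w n, w' n)"] by blast
  obtain x x' where l_eq: "l = (x, x')" by (cases l)
  have wx: "(\<lambda>n. w (s n)) \<longlonglongrightarrow> x" "(\<lambda>n. w' (s n)) \<longlonglongrightarrow> x'"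
    using tendsto_fst[OF lim] tendsto_snd[OF lim] by (simp_all add: l_eq o_def)
  have "x = x'"
  proof
    fix a
    have "(\<lambda>n. w' (s n) a - w (s n) a) \<longlonglongrightarrow> 0"
    proof (rule Lim_null_comparison)
      show "(\<lambda>n. 2 * B * inverse (real (Suc (s n)))) \<longlonglongrightarrow> 0"
        using tendsto_mult_right_zero[OF LIMSEQ_subseq_LIMSEQ[OF LIMSEQ_inverse_real_of_nat s], of "2 * B"]
        by (simp add: o_def)
      show "\<forall>\<^sub>F n in sequentially. norm (w' (s n) a - w (s n) a) \<le> 2 * B * inverse (real (Suc (s n)))"
        using eventually_ge_at_top[of "blk a"]
      proof eventually_elim
        case (elim n)
        then have "blk a \<le> s n" using seq_suble[OF s, of n] by linarith
        then show ?case using close[of a "s n"] by simp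
      qed
    qed
    moreover have "(\<lambda>n. w' (s n) a - w (s n) a) \<longlonglongrightarrow> x' a - x a"
      using wx unfolding tendsto_fun_iff by (intro tendsto_diff) auto
    ultimately show "x a = x' a" using LIMSEQ_unique by fastforce
  qed
  have "(\<lambda>n. \<phi> (w' (s n)) - \<phi> (w (s n))) \<longlonglongrightarrow> \<phi> x' - \<phi> x"
    using l w wx by (intro tendsto_diff continuous_on_tendsto_compose[OF \<phi>]) (auto simp: l_eq)
  moreover have "\<epsilon> \<le> \<phi> (w' (s n)) - \<phi> (w (s n))" for n
    using less[of "s n"] block_dist_nonneg[of "k (s n)" "w (s n)" "w' (s n)"] by linarith
  ultimately have "\<epsilon> \<le> \<phi> x' - \<phi> x" by (intro LIMSEQ_le_const) auto
  then show False using \<open>x = x'\<close> \<epsilon> by simp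
qed

abbreviation "cover_top \<equiv> top_of_set cover"
abbreviation "base_top \<equiv> top_of_set (products ` cover)"

text \<open>
  On the fiber through \<open>z\<close> the function \<open>peak k z\<close> is \<open>0\<close> at the points with the same first \<open>k\<close> blocks as
  \<open>z\<close> and negative elsewhere. Its measure is a continuous substitute for the density of the
  measure at this piece of the fiber.
\<close>

definition peak :: "nat \<Rightarrow> (nat \<Rightarrow> real) \<Rightarrow> (nat \<Rightarrow> real) \<Rightarrow> real" where
  "peak k z = (\<lambda>w\<in>cover. - block_dist k z w)"

lemma peak_in_C_fun: "peak k z \<in> C_fun cover_top"
  unfolding peak_def by (intro restrict_in_C_fun continuous_intros continuous_on_block_dist)

lemma fiber_peak:
  assumes "x \<in> cover" "products x = products z"
  obtains p where "p \<subseteq> {..<k}" "block_dist k (block_flip blk p z) x = 0"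
proof -
  obtain q where q: "x = block_flip blk q z" using assms(2) by (rule products_eqD)
  have "block_dist k (block_flip blk (q \<inter> {..<k}) z) x = 0"
    unfolding block_dist_def q by (auto simp: block_flip_def intro!: sum.neutral)
  then show thesis using that[of "q \<inter> {..<k}"] by blast
qed

text \<open>
  On the fiber through \<open>z\<close>, the function \<open>\<phi>\<close> is \<open>\<epsilon>\<close>-close to the maximum of its peaks
  \<open>\<phi> (block_flip blk p z) + peak k (block_flip blk p z)\<close>, by the Lipschitz condition; and a maximum of finitely many
  functions is respected by \<open>\<mu>\<close>. So the weights of the \<open>2\<^sup>k\<close> peaks determine \<open>\<mu> \<phi>\<close> up to \<open>\<epsilon>\<close>.
\<close>

lemma Max_peaks_bounds:
  assumes \<mu>: "\<mu> \<in> I_set cover_top" "I_map cover_top base_top products \<mu> = dirac base_top (products z)" and z: "z \<in> cover"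
    and \<phi>: "\<phi> \<in> C_fun cover_top"
    and Lip: "\<And>w w'. w \<in> cover \<Longrightarrow> w' \<in> cover \<Longrightarrow> \<phi> w' \<le> \<phi> w + \<epsilon> + block_dist k w w'"
  shows "\<bar>\<mu> \<phi> - (MAX p\<in>Pow {..<k}. \<phi> (block_flip blk p z) + \<mu> (peak k (block_flip blk p z)))\<bar> \<le> \<epsilon>"
proof -
  define F where "F p = C_odot cover_top (\<phi> (block_flip blk p z)) (peak k (block_flip blk p z))" for p
  have F: "F p \<in> C_fun cover_top" for p unfolding F_def by (intro C_odot_in_C_fun peak_in_C_fun)
  have F_eq: "F p x = \<phi> (block_flip blk p z) - block_dist k (block_flip blk p z) x" if "x \<in> cover" for p x
    using that by (simp add: F_def C_odot_def C_const_def peak_def)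
  define \<Psi> where "\<Psi> = (\<lambda>x\<in>topspace cover_top. MAX p\<in>Pow {..<k}. F p x)"
  have \<Psi>: "\<Psi> \<in> C_fun cover_top" "\<mu> \<Psi> = (MAX p\<in>Pow {..<k}. \<mu> (F p))"
    unfolding \<Psi>_def using I_set_Max[OF \<mu>(1), of "Pow {..<k}" F] F by auto
  have "\<mu> (F p) = \<phi> (block_flip blk p z) + \<mu> (peak k (block_flip blk p z))" for p
    unfolding F_def by (rule I_set_odot[OF \<mu>(1) peak_in_C_fun])
  then have \<mu>\<Psi>: "\<mu> \<Psi> = (MAX p\<in>Pow {..<k}. \<phi> (block_flip blk p z) + \<mu> (peak k (block_flip blk p z)))"
    using \<Psi>(2) by simp
  note le_fiber = I_set_le_if_le_on_fiber[OF compact_cover continuous_on_products order_refl \<mu>(1), of "products z"]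
  have di: "I_map cover_top base_top products \<mu> \<beta> = \<beta> (products z)" if "\<beta> \<in> C_fun base_top" for \<beta>
    unfolding \<mu>(2) using that by (simp add: dirac_def)
  have "\<mu> \<phi> \<le> \<mu> \<Psi> + \<epsilon>"
  proof (rule le_fiber[OF di])
    fix x assume x: "x \<in> cover" "products x = products z"
    then obtain p where p: "p \<subseteq> {..<k}" "block_dist k (block_flip blk p z) x = 0" by (rule fiber_peak)
    have "\<phi> x \<le> \<phi> (block_flip blk p z) + \<epsilon>" using Lip[OF block_flip_in_cover[OF z] x(1), of p] p by simp
    also have "\<phi> (block_flip blk p z) = F p x" using p F_eq[OF x(1)] by simp
    also have "F p x \<le> \<Psi> x" unfolding \<Psi>_def using x p by (auto intro!: Max_ge)
    finally show "\<phi> x \<le> \<Psi> x + \<epsilon>" by simp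
  qed (use z \<phi> \<Psi> in auto)
  moreover have "\<mu> \<Psi> \<le> \<mu> \<phi> + \<epsilon>"
  proof (rule le_fiber[OF di])
    fix x assume x: "x \<in> cover" "products x = products z"
    have "F p x \<le> \<phi> x + \<epsilon>" for p
      using Lip[OF x(1) block_flip_in_cover[OF z, of p]] F_eq[OF x(1), of p] by (simp add: block_dist_commute)
    then have "(MAX p\<in>Pow {..<k}. F p x) \<le> \<phi> x + \<epsilon>" by (intro Max.boundedI) auto
    then show "\<Psi> x \<le> \<phi> x + \<epsilon>" unfolding \<Psi>_def using x by simp
  qed (use z \<phi> \<Psi> in auto)
  ultimately show ?thesis unfolding \<mu>\<Psi> by linarith
qed

lemma Max_peak_weights:
  assumes \<mu>: "\<mu> \<in> I_set cover_top" "I_map cover_top base_top products \<mu> = dirac base_top (products z)" and z: "z \<in> cover"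
  shows "(MAX p\<in>Pow {..<k}. \<mu> (peak k (block_flip blk p z))) = 0"
proof -
  let ?c = "C_const cover_top 0"
  have "\<bar>\<mu> ?c - (MAX p\<in>Pow {..<k}. ?c (block_flip blk p z) + \<mu> (peak k (block_flip blk p z)))\<bar> \<le> 0"
    by (rule Max_peaks_bounds[OF \<mu> z C_const_in_C_fun]) (simp add: C_const_def block_dist_nonneg)
  moreover have "?c (block_flip blk p z) = 0" for p using block_flip_in_cover[OF z] by (simp add: C_const_def)
  ultimately show ?thesis by (simp add: I_set_const[OF \<mu>(1)])
qed

section \<open>Fourier coefficients on sign patterns\<close>

definition character :: "nat \<Rightarrow> nat set \<Rightarrow> real" where
  "character c p = (\<Prod>i\<in>p. if bit c i then - 1 else 1)"

lemma character_sym_diff_singleton: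
  assumes "finite p"
  shows "character c (sym_diff p {i}) = (if bit c i then - character c p else character c p)"
proof (cases "i \<in> p")
  case True
  then have "sym_diff p {i} = p - {i}" by auto
  then show ?thesis
    unfolding character_def using prod.remove[OF assms True, of "\<lambda>i. if bit c i then - 1 else (1::real)"] by simp
next
  case False
  then have "sym_diff p {i} = insert i p" by auto
  then show ?thesis unfolding character_def using False assms by simp
qed

lemma bij_betw_sym_diff_singleton: "i < k \<Longrightarrow> bij_betw (\<lambda>p. sym_diff p {i}) (Pow {..<k}) (Pow {..<k})"
  by (rule bij_betw_byWitness[where f' = "\<lambda>p. sym_diff p {i}"]) auto

lemma sum_character_eq_0:
  assumes "c \<in> {1..<2^k}"
  shows "(\<Sum>p\<in>Pow {..<k}. character c p) = 0"
proof -
  define i where "i = floor_log c"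
  have "2 ^ i \<le> c" using floor_log_exp2_le[of c] assms by (auto simp: i_def)
  also have "c < 2 ^ k" using assms by simp
  finally have i: "i < k" by simp
  have "bit c i" unfolding i_def by (rule bit_floor_log) (use assms in auto)
  have "(\<Sum>p\<in>Pow {..<k}. character c p) = (\<Sum>p\<in>Pow {..<k}. character c (sym_diff p {i}))"
    by (rule sum.reindex_bij_betw[OF bij_betw_sym_diff_singleton[OF i], symmetric])
  also have "\<dots> = (\<Sum>p\<in>Pow {..<k}. - character c p)"
    using \<open>bit c i\<close> by (intro sum.cong) (auto simp: character_sym_diff_singleton finite_subset)
  finally show ?thesis by (simp add: sum_negf)
qed

text \<open>
  Separating the sign patterns by whether they contain the last block, the characters \<open>c\<close> and
  \<open>c + 2\<^sup>k\<close> see the sum and the difference of the two halves.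
\<close>

lemma eq_0_if_all_coefficients_eq_0:
  assumes "\<And>c. c < 2^k \<Longrightarrow> (\<Sum>p\<in>Pow {..<k}. character c p * d p) = 0" and "p \<subseteq> {..<k}"
  shows "d p = 0"
  using assms
proof (induction k arbitrary: d p)
  case 0
  then show ?case by (force simp: character_def)
next
  case (Suc k)
  have split: "(\<Sum>p\<in>Pow {..<Suc k}. character c p * d p) =
      (\<Sum>p\<in>Pow {..<k}. character c p * (d p + (if bit c k then -1 else 1) * d (insert k p)))" for c
  proof -
    have "Pow {..<Suc k} = Pow {..<k} \<union> insert k ` Pow {..<k}"
      by (simp add: lessThan_Suc Pow_insert)
    moreover have "Pow {..<k} \<inter> insert k ` Pow {..<k} = {}" by auto
    moreover have "inj_on (insert k) (Pow {..<k})"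
      by (rule inj_onI) (auto simp: insert_ident)
    ultimately have "(\<Sum>p\<in>Pow {..<Suc k}. character c p * d p) =
      (\<Sum>p\<in>Pow {..<k}. character c p * d p) + (\<Sum>p\<in>Pow {..<k}. character c (insert k p) * d (insert k p))"
      by (simp add: sum.union_disjoint sum.reindex)
    also have "(\<Sum>p\<in>Pow {..<k}. character c (insert k p) * d (insert k p)) =
      (\<Sum>p\<in>Pow {..<k}. character c p * ((if bit c k then -1 else 1) * d (insert k p)))"
    proof (rule sum.cong[OF refl])
      fix p assume "p \<in> Pow {..<k}"
      then have "finite p" "k \<notin> p" by (auto intro: finite_subset)
      then show "character c (insert k p) * d (insert k p) =
          character c p * ((if bit c k then -1 else 1) * d (insert k p))"
        by (simp add: character_def)
    qed
    finally show ?thesis by (simp add: sum.distrib distrib_left)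
  qed
  have plus: "d p + d (insert k p) = 0" if "p \<subseteq> {..<k}" for p
  proof (rule Suc.IH[of "\<lambda>p. d p + d (insert k p)", OF _ that])
    fix c :: nat assume c: "c < 2 ^ k"
    then have "\<not> bit c k" by (simp add: bit_iff_odd)
    then show "(\<Sum>p\<in>Pow {..<k}. character c p * (d p + d (insert k p))) = 0"
      using Suc.prems(1)[of c] split[of c] c by simp
  qed
  have minus: "d p - d (insert k p) = 0" if "p \<subseteq> {..<k}" for p
  proof (rule Suc.IH[of "\<lambda>p. d p - d (insert k p)", OF _ that])
    fix c :: nat assume c: "c < 2 ^ k"
    then have b: "bit (c + 2 ^ k) k" by (simp add: bit_iff_odd)
    have "bit (c + 2 ^ k) i \<longleftrightarrow> bit c i" if "i < k" for i
      using that by (simp add: bit_iff_odd div_plus_div_distrib_dvd_right le_imp_power_dvd flip: power_diff)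
    then have "character (c + 2 ^ k) p = character c p" if "p \<subseteq> {..<k}" for p
      unfolding character_def using that by (intro prod.cong) auto
    then show "(\<Sum>p\<in>Pow {..<k}. character c p * (d p - d (insert k p))) = 0"
      using Suc.prems(1)[of "c + 2 ^ k"] split[of "c + 2 ^ k"] c b by simp
  qed
  show ?case
  proof (cases "k \<in> p")
    case True
    then have "insert k (p - {k}) = p" by auto
    moreover have "p - {k} \<subseteq> {..<k}" using Suc.prems(2) by (auto simp: lessThan_Suc)
    ultimately show ?thesis using plus[of "p - {k}"] minus[of "p - {k}"] by simp
  next
    case False
    then have "p \<subseteq> {..<k}" using Suc.prems(2) by (auto simp: lessThan_Suc)
    then show ?thesis using plus[of p] minus[of p] by simp
  qed
qed

lemma const_if_nontrivial_coefficients_eq_0: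
  assumes "\<And>c. c \<in> {1..<2^k} \<Longrightarrow> (\<Sum>p\<in>Pow {..<k}. character c p * d p) = 0"
  obtains m where "\<And>p. p \<subseteq> {..<k} \<Longrightarrow> d p = m"
proof -
  define m where "m = (\<Sum>p\<in>Pow {..<k}. d p) / 2 ^ k"
  have "d p - m = 0" if "p \<subseteq> {..<k}" for p
  proof (rule eq_0_if_all_coefficients_eq_0[of k "\<lambda>p. d p - m", OF _ that])
    fix c :: nat assume c: "c < 2 ^ k"
    show "(\<Sum>p\<in>Pow {..<k}. character c p * (d p - m)) = 0"
    proof (cases "c = 0")
      case True
      then show ?thesis by (simp add: character_def sum_subtractf m_def card_Pow)
    next
      case False
      then have "c \<in> {1..<2^k}" using c by auto
      then show ?thesis
        using assms[of c] sum_character_eq_0[of c k]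
        by (simp add: right_diff_distrib sum_subtractf flip: sum_distrib_right)
    qed
  qed
  then show thesis by (intro that[of m]) auto
qed

section \<open>Lifts of the Dirac measures meet\<close>

lemma peak_le: "x \<in> cover \<Longrightarrow> peak k u x \<le> peak k v x + block_dist k v u"
  using block_dist_triangle[of k v x u] by (simp add: peak_def)

text \<open>
  The nontrivial Fourier coefficients of the difference of the weights vanish simultaneously by
  \<open>equivariant_functions_common_zero\<close>. There the weights differ by a constant, which is \<open>0\<close> because
  both families of weights have maximum \<open>0\<close>.
\<close>

lemma lifts_agree_on_peaks:
  assumes s: "continuous_map base_top (I_top cover_top) s0" "continuous_map base_top (I_top cover_top) s1"
    and lift: "\<And>y. y \<in> products ` cover \<Longrightarrow> I_map cover_top base_top products (s0 y) = dirac base_top y"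
      "\<And>y. y \<in> products ` cover \<Longrightarrow> I_map cover_top base_top products (s1 y) = dirac base_top y"
  obtains z where "z \<in> cover" "\<And>p. p \<subseteq> {..<k} \<Longrightarrow>
    s0 (products z) (peak k (block_flip blk p z)) = s1 (products z) (peak k (block_flip blk p z))"
proof -
  define weight where "weight s z p = s (products z) (peak k (block_flip blk p z))"
    for s :: "(nat \<Rightarrow> real) \<Rightarrow> ((nat \<Rightarrow> real) \<Rightarrow> real) \<Rightarrow> real" and z p
  have I: "s (products z) \<in> I_set cover_top" if "continuous_map base_top (I_top cover_top) s" "z \<in> cover" for s z
    using continuous_map_image_subset_topspace[OF that(1)] that(2) by auto
  have cont: "continuous_on cover (\<lambda>z. weight s z p)" if s: "continuous_map base_top (I_top cover_top) s" for s p
  proof (subst continuous_on_def, intro ballI)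
    fix z assume z: "z \<in> cover"
    let ?P = "peak k (block_flip blk p z)"
    have "continuous_map base_top euclideanreal (\<lambda>y. s y ?P)"
      using continuous_map_compose[OF s continuous_map_I_top_eval[OF peak_in_C_fun]] by (simp add: o_def)
    then have "continuous_on (products ` cover) (\<lambda>y. s y ?P)" by simp
    then have "continuous_on cover (\<lambda>z'. s (products z') ?P)"
      by (rule continuous_on_compose2[OF _ continuous_on_products]) auto
    then have 1: "((\<lambda>z'. s (products z') ?P) \<longlongrightarrow> weight s z p) (at z within cover)"
      using z by (auto simp: continuous_on_def weight_def)
    have dist_cont: "continuous_on cover (\<lambda>z'. block_dist k (block_flip blk p z) (block_flip blk p z'))"
      by (rule continuous_on_compose2[OF continuous_on_block_dist[of UNIV] continuous_on_block_flip]) auto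
    have 2: "((\<lambda>z'. block_dist k (block_flip blk p z) (block_flip blk p z')) \<longlongrightarrow> 0) (at z within cover)"
    proof -
      have "block_dist k u u = 0" for u by (simp add: block_dist_def)
      then show ?thesis
        using dist_cont z unfolding continuous_on_def by metis
    qed
    have "\<bar>weight s z' p - s (products z') ?P\<bar> \<le> block_dist k (block_flip blk p z) (block_flip blk p z')"
      if "z' \<in> cover" for z'
    proof -
      let ?P' = "peak k (block_flip blk p z')" and ?d = "block_dist k (block_flip blk p z) (block_flip blk p z')"
      have "s (products z') ?P' \<le> s (products z') ?P + ?d"
        by (intro I_set_mono[OF I[OF s that] peak_in_C_fun peak_in_C_fun] peak_le) simp
      moreover have "s (products z') ?P \<le> s (products z') ?P' + ?d"
        unfolding block_dist_commute[of k "block_flip blk p z"]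
        by (intro I_set_mono[OF I[OF s that] peak_in_C_fun peak_in_C_fun] peak_le) simp
      ultimately show ?thesis by (simp add: weight_def)
    qed
    then have "((\<lambda>z'. weight s z' p - s (products z') ?P) \<longlongrightarrow> 0) (at z within cover)"
      by (intro Lim_null_comparison[OF _ 2]) (auto simp: eventually_at_filter)
    from tendsto_add[OF this 1] show "((\<lambda>z. weight s z p) \<longlongrightarrow> weight s z p) (at z within cover)" by simp
  qed
  define h where "h c z = (\<Sum>p\<in>Pow {..<k}. character c p * (weight s0 z p - weight s1 z p))" for c z
  have flip: "weight s (block_flip blk {i} z) p = weight s z (sym_diff p {i})" for s i z p
    by (simp add: weight_def block_flip_sym_diff)
  have "continuous_on cover (h c)" for c
    unfolding h_def by (intro continuous_intros cont s)
  moreover have "h c (block_flip blk {i} z) = (if bit c i then - h c z else h c z)" if "i < k" for c i z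
  proof -
    have "h c (block_flip blk {i} z) = (\<Sum>p\<in>Pow {..<k}. (if bit c i then - 1 else 1) *
        (character c (sym_diff p {i}) * (weight s0 z (sym_diff p {i}) - weight s1 z (sym_diff p {i}))))"
      unfolding h_def flip
      by (intro sum.cong) (auto simp: character_sym_diff_singleton finite_subset)
    also have "\<dots> = (if bit c i then - 1 else 1) * h c z"
      unfolding h_def sum_distrib_left [symmetric]
      by (subst sum.reindex_bij_betw[OF bij_betw_sym_diff_singleton[OF that],
            of "\<lambda>p. character c p * (weight s0 z p - weight s1 z p)"]) (rule refl)
    finally show ?thesis by simp
  qed
  ultimately obtain z where z: "z \<in> cover" and h0: "\<And>c. c \<in> {1..<2^k} \<Longrightarrow> h c z = 0"
    using equivariant_functions_common_zero[of k h] by metis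
  obtain m where m: "\<And>p. p \<subseteq> {..<k} \<Longrightarrow> weight s0 z p - weight s1 z p = m"
    using const_if_nontrivial_coefficients_eq_0[OF h0[unfolded h_def]] by metis
  have y: "products z \<in> products ` cover" using z by auto
  have Max0: "(MAX p\<in>Pow {..<k}. weight s0 z p) = 0" "(MAX p\<in>Pow {..<k}. weight s1 z p) = 0"
    unfolding weight_def
    using Max_peak_weights[OF I[OF s(1) z] lift(1)[OF y] z] Max_peak_weights[OF I[OF s(2) z] lift(2)[OF y] z]
    by simp_all
  have ne: "finite (f ` Pow {..<k})" "f ` Pow {..<k} \<noteq> {}" for f :: "nat set \<Rightarrow> real" by auto
  have le: "weight s0 z p \<le> 0" "weight s1 z p \<le> 0" if "p \<subseteq> {..<k}" for p
    using Max_ge[OF ne(1)] that Max0 by (metis PowI imageI)+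
  obtain p0 where p0: "p0 \<subseteq> {..<k}" "weight s0 z p0 = 0"
    using Max_in[OF ne, of "weight s0 z"] Max0 by auto
  obtain p1 where p1: "p1 \<subseteq> {..<k}" "weight s1 z p1 = 0"
    using Max_in[OF ne, of "weight s1 z"] Max0 by auto
  have "m = 0" using m[OF p0(1)] m[OF p1(1)] p0 p1 le(1)[OF p1(1)] le(2)[OF p0(1)] by linarith
  then show thesis using m by (intro that[OF z]) (auto simp: weight_def)
qed

lemma lifts_meet:
  assumes s: "continuous_map base_top (I_top cover_top) s0" "continuous_map base_top (I_top cover_top) s1"
    and lift: "\<And>y. y \<in> products ` cover \<Longrightarrow> I_map cover_top base_top products (s0 y) = dirac base_top y"
      "\<And>y. y \<in> products ` cover \<Longrightarrow> I_map cover_top base_top products (s1 y) = dirac base_top y"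
  obtains y where "y \<in> products ` cover" "s0 y = s1 y"
proof -
  have "\<forall>k. \<exists>z\<in>cover. \<forall>p\<subseteq>{..<k}.
    s0 (products z) (peak k (block_flip blk p z)) = s1 (products z) (peak k (block_flip blk p z))"
    using lifts_agree_on_peaks[OF s lift] by metis
  then obtain z where z: "\<And>k. z k \<in> cover" and agree: "\<And>k p. p \<subseteq> {..<k} \<Longrightarrow>
    s0 (products (z k)) (peak k (block_flip blk p (z k))) = s1 (products (z k)) (peak k (block_flip blk p (z k)))"
    by metis
  obtain l r where l: "l \<in> cover" and r: "strict_mono r" and lim: "(z \<circ> r) \<longlonglongrightarrow> l"
    using seq_compactE[OF compact_imp_seq_compact[OF compact_cover], of z] z by blast
  have I: "s y \<in> I_set cover_top" if "continuous_map base_top (I_top cover_top) s" "y \<in> products ` cover" for s y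
    using Pi_mem[OF continuous_map_funspace[OF that(1)], of y] that(2) by simp
  have "s0 (products l) \<phi> = s1 (products l) \<phi>" if \<phi>: "\<phi> \<in> C_fun cover_top" for \<phi>
  proof -
    have lim_s: "(\<lambda>n. s (products (z (r n))) \<phi>) \<longlonglongrightarrow> s (products l) \<phi>"
      if s: "continuous_map base_top (I_top cover_top) s" for s
    proof -
      have "continuous_map base_top euclideanreal (\<lambda>y. s y \<phi>)"
        using continuous_map_compose[OF s continuous_map_I_top_eval[OF \<phi>]] by (simp add: o_def)
      then have "continuous_on (products ` cover) (\<lambda>y. s y \<phi>)" by simp
      then have "continuous_on cover (\<lambda>z. s (products z) \<phi>)"
        by (rule continuous_on_compose2[OF _ continuous_on_products]) auto
      from continuous_on_tendsto_compose[OF this lim l] show ?thesis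
        using z by (simp add: o_def)
    qed
    have "\<bar>s0 (products l) \<phi> - s1 (products l) \<phi>\<bar> \<le> 0 + \<delta>" if "0 < \<delta>" for \<delta>
    proof -
      obtain K where K: "\<And>k w w'. K \<le> k \<Longrightarrow> w \<in> cover \<Longrightarrow> w' \<in> cover \<Longrightarrow>
          \<phi> w' \<le> \<phi> w + \<delta>/2 + block_dist k w w'"
        using eventually_block_Lipschitz[of \<phi> "\<delta>/2"] \<phi> \<open>0 < \<delta>\<close> by (auto simp: C_fun_top_of_set)
      have "\<bar>s0 (products (z k)) \<phi> - s1 (products (z k)) \<phi>\<bar> \<le> \<delta>" if k: "K \<le> k" for k
      proof -
        have y: "products (z k) \<in> products ` cover" using z by auto
        let ?M = "\<lambda>s. MAX p\<in>Pow {..<k}. \<phi> (block_flip blk p (z k)) + s (products (z k)) (peak k (block_flip blk p (z k)))"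
        have "\<bar>s0 (products (z k)) \<phi> - ?M s0\<bar> \<le> \<delta>/2"
          by (rule Max_peaks_bounds[OF I[OF s(1) y] lift(1)[OF y] z \<phi>]) (rule K[OF k])
        moreover have "\<bar>s1 (products (z k)) \<phi> - ?M s1\<bar> \<le> \<delta>/2"
          by (rule Max_peaks_bounds[OF I[OF s(2) y] lift(2)[OF y] z \<phi>]) (rule K[OF k])
        moreover have "?M s0 = ?M s1" using agree[of _ k] by (intro arg_cong[where f = Max] image_cong) auto
        ultimately show ?thesis by linarith
      qed
      then have "\<forall>n\<ge>K. \<bar>s0 (products (z (r n))) \<phi> - s1 (products (z (r n))) \<phi>\<bar> \<le> \<delta>"
        using seq_suble[OF r] order_trans by blast
      then have "\<bar>s0 (products l) \<phi> - s1 (products l) \<phi>\<bar> \<le> \<delta>"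
        by (intro LIMSEQ_le_const2[OF tendsto_rabs[OF tendsto_diff[OF lim_s[OF s(1)] lim_s[OF s(2)]]]]) auto
      then show ?thesis by simp
    qed
    then have "\<bar>s0 (products l) \<phi> - s1 (products l) \<phi>\<bar> \<le> 0" by (rule field_le_epsilon)
    then show ?thesis by simp
  qed
  moreover have y: "products l \<in> products ` cover" using l by auto
  ultimately have "s0 (products l) = s1 (products l)"
    using I[OF s(1) y] I[OF s(2) y] by (intro extensionalityI[of _ "C_fun cover_top"]) (auto simp: I_set_def)
  with y show thesis by (rule that)
qed

theorem mainTheorem3:
  shows "\<exists>(X :: (nat \<Rightarrow> real) topology) (Y :: (nat \<Rightarrow> real) topology) f.
    compact_space X \<and> metrizable_space X \<and>
    compact_space Y \<and> metrizable_space Y \<and>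
    continuous_map X Y f \<and> open_map X Y f \<and>
    (\<forall>y\<in>topspace Y. infinite {x \<in> topspace X. f x = y}) \<and>
    \<not> trivial_Q_bundle (I_top X) (I_top Y) (I_map X Y f)"
proof (intro exI conjI ballI)
  show "compact_space cover_top" by (simp add: compact_cover compact_space_subtopology)
  show "compact_space base_top"
    using compact_continuous_image[OF continuous_on_products compact_cover]
    by (simp add: compact_space_subtopology)
  show "metrizable_space cover_top" "metrizable_space base_top"
    by (simp_all add: metrizable_space_euclidean metrizable_space_subtopology)
  show "continuous_map cover_top base_top products" by (simp add: continuous_on_products)
  show "open_map cover_top base_top products" by (rule open_map_products)
  show "infinite {x \<in> topspace cover_top. products x = y}" if "y \<in> topspace base_top" for y
    using that infinite_fiber by auto
  show "\<not> trivial_Q_bundle (I_top cover_top) (I_top base_top) (I_map cover_top base_top products)"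
  proof
    assume "trivial_Q_bundle (I_top cover_top) (I_top base_top) (I_map cover_top base_top products)"
    from trivial_Q_bundle_disjoint_lifts[OF this continuous_map_dirac] obtain s0 s1
      where s: "continuous_map base_top (I_top cover_top) s0" "continuous_map base_top (I_top cover_top) s1"
        and lift: "\<And>y. y \<in> topspace base_top \<Longrightarrow> I_map cover_top base_top products (s0 y) = dirac base_top y"
          "\<And>y. y \<in> topspace base_top \<Longrightarrow> I_map cover_top base_top products (s1 y) = dirac base_top y"
        and ne: "\<And>y. y \<in> topspace base_top \<Longrightarrow> s0 y \<noteq> s1 y"
      by blast
    then obtain y where "y \<in> products ` cover" "s0 y = s1 y"
      using lifts_meet[OF s] by (metis topspace_euclidean_subtopology)
    then show False using ne by simp
  qed
qed

end
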